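(* Let $n\in\mathbb{N}$, let $L:[a,b]\times\mathbb{R}^{n+1}\to\mathbb{R}$ and $\phi:[a,b]\times\mathbb{R}\to\mathbb{R}$ be of class $C^1$, and let $x_a,x_a^1,\ldots,x_a^{n-1}\in\mathbb{R}$ be fixed. Suppose that $(x,T)$ gives a minimum on $D$ to the functional $$\mathcal{J}(x,T)=\int_a^TL[x]_\gamma^{\alpha,\beta}(t)\,dt+\phi(T,x(T))$$ subject to $x(a)=x_a$ and $x^{(i)}(a)=x_a^i$ for all $i\in\{1,\ldots,n-1\}$ ($T$ and $x(T)$ being free). Then $(x,T)$ satisfies the fractional Euler--Lagrange equations $$\partial_2L[x]_\gamma^{\alpha,\beta}(t)+\sum_{i=1}^nD_{\overline{\gamma^i}}^{\beta_i(\cdot,\cdot),\alpha_i(\cdot,\cdot)}\partial_{i+2}L[x]_\gamma^{\alpha,\beta}(t)=0$$ on the interval $[a,T]$, and $$\sum_{i=1}^n\gamma_2^i\left({}_aD_t^{\beta_i(\cdot,\cdot)}\partial_{i+2}L[x]_\gamma^{\alpha,\beta}(t)-{}_TD_t^{\beta_i(\cdot,\cdot)}\partial_{i+2}L[x]_\gamma^{\alpha,\beta}(t)\right)=0$$ on the interval $[T,b]$. Moreover, $(x,T)$ satisfies the transversality conditions $$L[x]_\gamma^{\alpha,\beta}(T)+\partial_1\phi(T,x(T))+\partial_2\phi(T,x(T))x'(T)=0,$$ $$\sum_{i=1}^n\left[\gamma_1^i(-1)^{i-1}\frac{d^{i-1}}{dt^{i-1}}\,{}_tI_T^{i-\alpha_i(\cdot,\cdot)}\partial_{i+2}L[x]_\gamma^{\alpha,\beta}(t)-\gamma_2^i\frac{d^{i-1}}{dt^{i-1}}\,{}_TI_t^{i-\beta_i(\cdot,\cdot)}\partial_{i+2}L[x]_\gamma^{\alpha,\beta}(t)\right]_{t=T}+\partial_2\phi(T,x(T))=0,$$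 for all $j=1,\ldots,n-1$, $$\sum_{i=j+1}^n\left[\gamma_1^i(-1)^{i-1-j}\frac{d^{i-1-j}}{dt^{i-1-j}}\,{}_tI_T^{i-\alpha_i(\cdot,\cdot)}\partial_{i+2}L[x]_\gamma^{\alpha,\beta}(t)+\gamma_2^i(-1)^{j+1}\frac{d^{i-1-j}}{dt^{i-1-j}}\,{}_TI_t^{i-\beta_i(\cdot,\cdot)}\partial_{i+2}L[x]_\gamma^{\alpha,\beta}(t)\right]_{t=T}=0,$$ and for all $j=0,\ldots,n-1$, $$\sum_{i=j+1}^n\left[\gamma_2^i(-1)^{j+1}\left[\frac{d^{i-1-j}}{dt^{i-1-j}}\,{}_aI_t^{i-\beta_i(\cdot,\cdot)}\partial_{i+2}L[x]_\gamma^{\alpha,\beta}(t)-\frac{d^{i-1-j}}{dt^{i-1-j}}\,{}_TI_t^{i-\beta_i(\cdot,\cdot)}\partial_{i+2}L[x]_\gamma^{\alpha,\beta}(t)\right]\right]_{t=b}=0.$$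
   Context: Let $a<b$ be reals. For $i\in\{1,\ldots,n\}$ let $\alpha_i,\beta_i:[a,b]^2\to(i-1,i)$ be continuous and $\gamma^i=(\gamma_1^i,\gamma_2^i)\in[0,1]^2$ a vector with components not both zero; $\overline{\gamma^i}=(\gamma_2^i,\gamma_1^i)$. For $c\in[a,b]$ and $\delta\in\{\alpha_i,\beta_i\}$ define $${}_cI_t^{i-\delta(\cdot,\cdot)}f(t)=\int_c^t\frac{(t-\tau)^{i-1-\delta(t,\tau)}}{\Gamma(i-\delta(t,\tau))}f(\tau)\,d\tau,\qquad {}_tI_c^{i-\delta(\cdot,\cdot)}f(t)=\int_t^c\frac{(\tau-t)^{i-1-\delta(\tau,t)}}{\Gamma(i-\delta(\tau,t))}f(\tau)\,d\tau,$$ the Riemann--Liouville derivatives ${}_cD_t^{\delta(\cdot,\cdot)}f=\frac{d^i}{dt^i}\,{}_cI_t^{i-\delta(\cdot,\cdot)}f$ and ${}_tD_c^{\delta(\cdot,\cdot)}f=(-1)^i\frac{d^i}{dt^i}\,{}_tI_c^{i-\delta(\cdot,\cdot)}f$, and the Caputo derivatives ${}_a^CD_t^{\alpha_i(\cdot,\cdot)}x={}_aI_t^{i-\alpha_i(\cdot,\cdot)}x^{(i)}$ and ${}_t^CD_b^{\beta_i(\cdot,\cdot)}x=(-1)^i\,{}_tI_b^{i-\beta_i(\cdot,\cdot)}x^{(i)}$. Combined Caputo derivative: ${}^CD_{\gamma^i}^{\alpha_i(\cdot,\cdot),\beta_i(\cdot,\cdot)}x=\gamma_1^i\,{}_a^CD_t^{\alpha_i(\cdot,\cdot)}x+\gamma_2^i\,{}_t^CD_b^{\beta_i(\cdot,\cdot)}x$.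 Dual derivative: $D_{\overline{\gamma^i}}^{\beta_i(\cdot,\cdot),\alpha_i(\cdot,\cdot)}=\gamma_2^i\,{}_aD_t^{\beta_i(\cdot,\cdot)}+\gamma_1^i\,{}_tD_T^{\alpha_i(\cdot,\cdot)}$. Notation: $[x]_\gamma^{\alpha,\beta}(t)=\left(t,x(t),{}^CD_{\gamma^1}^{\alpha_1(\cdot,\cdot),\beta_1(\cdot,\cdot)}x(t),\ldots,{}^CD_{\gamma^n}^{\alpha_n(\cdot,\cdot),\beta_n(\cdot,\cdot)}x(t)\right)$; $L[x]_\gamma^{\alpha,\beta}(t)$ is $L$ evaluated at this vector; $\partial_i$ is the partial derivative with respect to the $i$th argument. $D$ is the set of $(x,t)\in C^n([a,b])\times[a,b]$ such that ${}^CD_{\gamma^i}^{\alpha_i(\cdot,\cdot),\beta_i(\cdot,\cdot)}x$ exists and is continuous on $[a,b]$ for all $i\in\{1,\ldots,n\}$, endowed with the norm $\|(x,t)\|=\max_{[a,b]}|x|+\max_{[a,b]}\sum_{i=1}^n|{}^CD_{\gamma^i}^{\alpha_i(\cdot,\cdot),\beta_i(\cdot,\cdot)}x|+|t|$.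
   Formalization: T is assumed interior, a<T<b (the first transversality condition fails at T=b for L=-1, φ=0); identities hold at points where their derivatives exist; the conditions at t=T also assume the order i-1-j derivatives of the left integrals from a exist at T (if γ_2^i≠0). *)

theory Defs
  imports "HOL-Analysis.Analysis"
begin

text \<open>Iterated derivative relative to an interval \<open>S\<close>: two-sided inside \<open>S\<close> and one-sided at the
  end points that belong to \<open>S\<close>.\<close>

primrec nth_deriv :: "real set \<Rightarrow> nat \<Rightarrow> (real \<Rightarrow> real) \<Rightarrow> real \<Rightarrow> real" where
  "nth_deriv S 0 f = f"
| "nth_deriv S (Suc k) f = (\<lambda>t. vector_derivative (nth_deriv S k f) (at t within S))"

text \<open>\<open>nth_deriv\<close> is a total function; the next predicate says that the \<open>k\<close>-th derivative at \<open>t\<close>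
  really exists (hence all lower derivatives exist near \<open>t\<close>).\<close>

primrec nth_differentiable_at :: "real set \<Rightarrow> nat \<Rightarrow> (real \<Rightarrow> real) \<Rightarrow> real \<Rightarrow> bool" where
  "nth_differentiable_at S 0 f t \<longleftrightarrow> True"
| "nth_differentiable_at S (Suc k) f t \<longleftrightarrow>
     nth_differentiable_at S k f t \<and>
     (\<forall>\<^sub>F s in at t within S. nth_differentiable_at S k f s) \<and>
     nth_deriv S k f differentiable (at t within S)"

definition C_on :: "nat \<Rightarrow> real set \<Rightarrow> (real \<Rightarrow> real) \<Rightarrow> bool" where
  "C_on n S f \<longleftrightarrow>
     (\<forall>k<n. \<forall>t\<in>S. nth_deriv S k f differentiable (at t within S)) \<and>
     continuous_on S (nth_deriv S n f)"

text \<open>The set \<open>[a,b] \<times> \<real>\<^sup>m\<^sup>-\<^sup>1\<close>. Its points are families indexed by \<open>1, \<dots>, m\<close>, extended by \<open>0\<close>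
  to all of \<open>nat\<close>; on this set the product topology of \<open>nat \<Rightarrow> real\<close> is the Euclidean one.\<close>

definition slab :: "real \<Rightarrow> real \<Rightarrow> nat \<Rightarrow> (nat \<Rightarrow> real) set" where
  "slab a b m = {v. v 1 \<in> {a..b} \<and> (\<forall>k. k \<notin> {1..m} \<longrightarrow> v k = 0)}"

text \<open>Partial derivative of \<open>F : A \<rightarrow> \<real>\<close> with respect to the \<open>k\<close>-th argument; only values of \<open>F\<close>
  on \<open>A\<close> matter.\<close>

definition partial_deriv ::
  "(nat \<Rightarrow> real) set \<Rightarrow> nat \<Rightarrow> ((nat \<Rightarrow> real) \<Rightarrow> real) \<Rightarrow> (nat \<Rightarrow> real) \<Rightarrow> real" where
  "partial_deriv A k F v =
     vector_derivative (\<lambda>s. F (v(k := s))) (at (v k) within {s. v(k := s) \<in> A})"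

definition C1_slab :: "real \<Rightarrow> real \<Rightarrow> nat \<Rightarrow> ((nat \<Rightarrow> real) \<Rightarrow> real) \<Rightarrow> bool" where
  "C1_slab a b m F \<longleftrightarrow>
     (\<forall>k\<in>{1..m}.
        (\<forall>v\<in>slab a b m. (\<lambda>s. F (v(k := s))) differentiable
            (at (v k) within {s. v(k := s) \<in> slab a b m})) \<and>
        continuous_on (slab a b m) (partial_deriv (slab a b m) k F))"

text \<open>Fractional integrals of variable order \<open>i - \<delta>(\<cdot>,\<cdot>)\<close>. At the singularity \<open>u = v\<close> of the kernel,
  \<open>0 powr e = 0\<close>, which does not affect the integrals.\<close>

definition frac_kernel :: "nat \<Rightarrow> (real \<Rightarrow> real \<Rightarrow> real) \<Rightarrow> real \<Rightarrow> real \<Rightarrow> real" where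
  "frac_kernel i \<delta> u v = (u - v) powr (real i - 1 - \<delta> u v) / Gamma (real i - \<delta> u v)"

definition left_int ::
  "nat \<Rightarrow> (real \<Rightarrow> real \<Rightarrow> real) \<Rightarrow> real \<Rightarrow> (real \<Rightarrow> real) \<Rightarrow> real \<Rightarrow> real" where
  "left_int i \<delta> c f t = integral {c..t} (\<lambda>\<tau>. frac_kernel i \<delta> t \<tau> * f \<tau>)"

definition right_int ::
  "nat \<Rightarrow> (real \<Rightarrow> real \<Rightarrow> real) \<Rightarrow> real \<Rightarrow> (real \<Rightarrow> real) \<Rightarrow> real \<Rightarrow> real" where
  "right_int i \<delta> c f t = integral {t..c} (\<lambda>\<tau>. frac_kernel i \<delta> \<tau> t * f \<tau>)"

text \<open>Riemann--Liouville derivatives, for functions on \<open>[a,b]\<close>: the left one with base point \<open>c\<close> lives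
  on \<open>[c,b]\<close> and the right one on \<open>[a,c]\<close>.\<close>

definition left_RL ::
  "real \<Rightarrow> nat \<Rightarrow> (real \<Rightarrow> real \<Rightarrow> real) \<Rightarrow> real \<Rightarrow> (real \<Rightarrow> real) \<Rightarrow> real \<Rightarrow> real" where
  "left_RL b i \<delta> c f t = nth_deriv {c..b} i (left_int i \<delta> c f) t"

definition right_RL ::
  "real \<Rightarrow> nat \<Rightarrow> (real \<Rightarrow> real \<Rightarrow> real) \<Rightarrow> real \<Rightarrow> (real \<Rightarrow> real) \<Rightarrow> real \<Rightarrow> real" where
  "right_RL a i \<delta> c f t = (- 1) ^ i * nth_deriv {a..c} i (right_int i \<delta> c f) t"

definition left_Caputo ::
  "real \<Rightarrow> real \<Rightarrow> nat \<Rightarrow> (real \<Rightarrow> real \<Rightarrow> real) \<Rightarrow> (real \<Rightarrow> real) \<Rightarrow> real \<Rightarrow> real" where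
  "left_Caputo a b i \<delta> x t = left_int i \<delta> a (nth_deriv {a..b} i x) t"

definition right_Caputo ::
  "real \<Rightarrow> real \<Rightarrow> nat \<Rightarrow> (real \<Rightarrow> real \<Rightarrow> real) \<Rightarrow> (real \<Rightarrow> real) \<Rightarrow> real \<Rightarrow> real" where
  "right_Caputo a b i \<delta> x t = (- 1) ^ i * right_int i \<delta> b (nth_deriv {a..b} i x) t"

definition comb_Caputo ::
  "real \<Rightarrow> real \<Rightarrow> nat \<Rightarrow> (real \<Rightarrow> real \<Rightarrow> real) \<Rightarrow> (real \<Rightarrow> real \<Rightarrow> real) \<Rightarrow> real \<times> real
    \<Rightarrow> (real \<Rightarrow> real) \<Rightarrow> real \<Rightarrow> real" where
  "comb_Caputo a b i \<alpha> \<beta> g x t =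
     fst g * left_Caputo a b i \<alpha> x t + snd g * right_Caputo a b i \<beta> x t"

definition comb_Caputo_exists ::
  "real \<Rightarrow> real \<Rightarrow> nat \<Rightarrow> (real \<Rightarrow> real \<Rightarrow> real) \<Rightarrow> (real \<Rightarrow> real \<Rightarrow> real)
    \<Rightarrow> (real \<Rightarrow> real) \<Rightarrow> bool" where
  "comb_Caputo_exists a b i \<alpha> \<beta> x \<longleftrightarrow>
     (\<forall>t\<in>{a..b}.
        (\<lambda>\<tau>. frac_kernel i \<alpha> t \<tau> * nth_deriv {a..b} i x \<tau>) integrable_on {a..t} \<and>
        (\<lambda>\<tau>. frac_kernel i \<beta> \<tau> t * nth_deriv {a..b} i x \<tau>) integrable_on {t..b})"

definition dual_deriv ::
  "real \<Rightarrow> real \<Rightarrow> real \<Rightarrow> nat \<Rightarrow> (real \<Rightarrow> real \<Rightarrow> real) \<Rightarrow> (real \<Rightarrow> real \<Rightarrow> real) \<Rightarrow> real \<times> real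
    \<Rightarrow> (real \<Rightarrow> real) \<Rightarrow> real \<Rightarrow> real" where
  "dual_deriv a b T i \<alpha> \<beta> g f t = snd g * left_RL b i \<beta> a f t + fst g * right_RL a i \<alpha> T f t"

text \<open>The vector \<open>[x](t) = (t, x(t), D\<^sub>1x(t), \<dots>, D\<^sub>nx(t))\<close> of the \<open>n + 2\<close> arguments of the Lagrangian.\<close>

definition args ::
  "real \<Rightarrow> real \<Rightarrow> nat \<Rightarrow> (nat \<Rightarrow> real \<Rightarrow> real \<Rightarrow> real) \<Rightarrow> (nat \<Rightarrow> real \<Rightarrow> real \<Rightarrow> real)
    \<Rightarrow> (nat \<Rightarrow> real \<times> real) \<Rightarrow> (real \<Rightarrow> real) \<Rightarrow> real \<Rightarrow> (nat \<Rightarrow> real)" where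
  "args a b n \<alpha> \<beta> \<gamma> x t =
     (\<lambda>k. if k = 1 then t
          else if k = 2 then x t
          else if k \<in> {3..n+2} then comb_Caputo a b (k-2) (\<alpha> (k-2)) (\<beta> (k-2)) (\<gamma> (k-2)) x t
          else 0)"

definition D_set ::
  "real \<Rightarrow> real \<Rightarrow> nat \<Rightarrow> (nat \<Rightarrow> real \<Rightarrow> real \<Rightarrow> real) \<Rightarrow> (nat \<Rightarrow> real \<Rightarrow> real \<Rightarrow> real)
    \<Rightarrow> (nat \<Rightarrow> real \<times> real) \<Rightarrow> ((real \<Rightarrow> real) \<times> real) set" where
  "D_set a b n \<alpha> \<beta> \<gamma> =
     {(x, t). C_on n {a..b} x \<and> t \<in> {a..b} \<and>
        (\<forall>i\<in>{1..n}. comb_Caputo_exists a b i (\<alpha> i) (\<beta> i) x \<and>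
           continuous_on {a..b} (comb_Caputo a b i (\<alpha> i) (\<beta> i) (\<gamma> i) x))}"

definition D_norm ::
  "real \<Rightarrow> real \<Rightarrow> nat \<Rightarrow> (nat \<Rightarrow> real \<Rightarrow> real \<Rightarrow> real) \<Rightarrow> (nat \<Rightarrow> real \<Rightarrow> real \<Rightarrow> real)
    \<Rightarrow> (nat \<Rightarrow> real \<times> real) \<Rightarrow> (real \<Rightarrow> real) \<times> real \<Rightarrow> real" where
  "D_norm a b n \<alpha> \<beta> \<gamma> = (\<lambda>(x, t).
     (SUP s\<in>{a..b}. \<bar>x s\<bar>)
     + (SUP s\<in>{a..b}. \<Sum>i=1..n. \<bar>comb_Caputo a b i (\<alpha> i) (\<beta> i) (\<gamma> i) x s\<bar>) + \<bar>t\<bar>)"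

definition J_fun ::
  "real \<Rightarrow> real \<Rightarrow> nat \<Rightarrow> (nat \<Rightarrow> real \<Rightarrow> real \<Rightarrow> real) \<Rightarrow> (nat \<Rightarrow> real \<Rightarrow> real \<Rightarrow> real)
    \<Rightarrow> (nat \<Rightarrow> real \<times> real) \<Rightarrow> ((nat \<Rightarrow> real) \<Rightarrow> real) \<Rightarrow> (real \<Rightarrow> real \<Rightarrow> real)
    \<Rightarrow> (real \<Rightarrow> real) \<Rightarrow> real \<Rightarrow> real" where
  "J_fun a b n \<alpha> \<beta> \<gamma> L \<phi> x T =
     integral {a..T} (\<lambda>t. L (args a b n \<alpha> \<beta> \<gamma> x t)) + \<phi> T (x T)"

definition initial_conds ::
  "real \<Rightarrow> real \<Rightarrow> nat \<Rightarrow> real \<Rightarrow> (nat \<Rightarrow> real) \<Rightarrow> (real \<Rightarrow> real) \<Rightarrow> bool" where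
  "initial_conds a b n xa xa' x \<longleftrightarrow>
     x a = xa \<and> (\<forall>i\<in>{1..n-1}. nth_deriv {a..b} i x a = xa' i)"

text \<open>Minimality with respect to the norm of \<open>D\<close>, among the pairs in \<open>D\<close> that satisfy the initial
  conditions. A global minimum is a special case.\<close>

definition gives_minimum ::
  "real \<Rightarrow> real \<Rightarrow> nat \<Rightarrow> (nat \<Rightarrow> real \<Rightarrow> real \<Rightarrow> real) \<Rightarrow> (nat \<Rightarrow> real \<Rightarrow> real \<Rightarrow> real)
    \<Rightarrow> (nat \<Rightarrow> real \<times> real) \<Rightarrow> ((nat \<Rightarrow> real) \<Rightarrow> real) \<Rightarrow> (real \<Rightarrow> real \<Rightarrow> real)
    \<Rightarrow> real \<Rightarrow> (nat \<Rightarrow> real) \<Rightarrow> (real \<Rightarrow> real) \<Rightarrow> real \<Rightarrow> bool" where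
  "gives_minimum a b n \<alpha> \<beta> \<gamma> L \<phi> xa xa' x T \<longleftrightarrow>
     (x, T) \<in> D_set a b n \<alpha> \<beta> \<gamma> \<and> initial_conds a b n xa xa' x \<and>
     (\<exists>\<epsilon>>0. \<forall>y S. (y, S) \<in> D_set a b n \<alpha> \<beta> \<gamma> \<and> initial_conds a b n xa xa' y \<and>
        D_norm a b n \<alpha> \<beta> \<gamma> (\<lambda>t. y t - x t, S - T) < \<epsilon> \<longrightarrow>
        J_fun a b n \<alpha> \<beta> \<gamma> L \<phi> x T \<le> J_fun a b n \<alpha> \<beta> \<gamma> L \<phi> y S)"

definition partial_L ::
  "real \<Rightarrow> real \<Rightarrow> nat \<Rightarrow> (nat \<Rightarrow> real \<Rightarrow> real \<Rightarrow> real) \<Rightarrow> (nat \<Rightarrow> real \<Rightarrow> real \<Rightarrow> real)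
    \<Rightarrow> (nat \<Rightarrow> real \<times> real) \<Rightarrow> ((nat \<Rightarrow> real) \<Rightarrow> real) \<Rightarrow> (real \<Rightarrow> real) \<Rightarrow> nat \<Rightarrow> real \<Rightarrow> real" where
  "partial_L a b n \<alpha> \<beta> \<gamma> L x k t =
     partial_deriv (slab a b (n+2)) k L (args a b n \<alpha> \<beta> \<gamma> x t)"

end

theory Submission
  imports Defs
begin

text \<open>
  Variations \<open>h\<close> are taken as \<open>n\<close>-fold primitives of continuous functions, so that they satisfy the
  homogeneous initial conditions at \<open>a\<close> and are free at \<open>T\<close> and \<open>b\<close>. The first variation involves
  only \<open>h, \<dots>, h\<^sup>(\<^sup>n\<^sup>)\<close> once the fractional operators are moved onto the derivatives of \<open>L\<close> by
  fractional integration by parts. Integrating by parts the other way (raising the order of the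
  derivative of \<open>h\<close>) needs no regularity of the fractional integrals and produces costates
  \<open>e\<^sub>k\<close> with \<open>e\<^sub>k\<^sub>+\<^sub>1' = - (N\<^sub>k + e\<^sub>k)\<close>, \<open>e\<^sub>0 = 0\<close> and \<open>e\<^sub>n\<^sub>+\<^sub>1 = 0\<close> on \<open>[a,T]\<close> and on \<open>[T,b]\<close>. Wherever the
  derivatives of the \<open>N\<^sub>i\<close> exist at a point, downward induction on \<open>k\<close> there gives
  \<open>e\<^sub>k = - \<Sum>\<^sub>i\<^sub>\<ge>\<^sub>k (-1)\<^sup>i\<^sup>-\<^sup>k N\<^sub>i\<^sup>(\<^sup>i\<^sup>-\<^sup>k\<^sup>)\<close>. The Euler--Lagrange equations are \<open>e\<^sub>0 = 0\<close>; the transversality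
  conditions are the known values of \<open>e\<^sub>k\<close> at \<open>b\<close> and its jump at \<open>T\<close>, which is nonzero only for
  \<open>k = 1\<close>.
\<close>

subsection \<open>Iterated one-sided derivatives\<close>

text \<open>The end time and the function are varied separately: moving T with x fixed gives the
  first transversality condition, and moving x with T fixed gives everything else. The interval from
  T to b enters although J integrates only up to T, because the right Caputo derivative at a point
  before T depends on x up to b. A pairing with it over \<open>{a..T}\<close> is the pairing over
  \<open>{a..b}\<close> minus the one over \<open>{T..b}\<close>, and these two have different
  adjoints, based at a and at T. The fractional integrals of the partial derivatives of L are only
  known to be continuous, and their differentiability is assumed point by point, so derivatives
  cannot be moved onto them under an integral. The costates are therefore built as iterated
  integrals, and derivatives of the fractional integrals enter only when a costate is evaluated at a
  single point.\<close>

lemma vderiv_within_Icc: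
  fixes f :: "real \<Rightarrow> real"
  assumes "(f has_vector_derivative D) (at t within {c..d})" "c < d" "t \<in> {c..d}"
  shows "vector_derivative f (at t within {c..d}) = D"
  using assms by (intro vector_derivative_within_closed_interval) auto

lemma nth_deriv_chain:
  assumes "c < d"
    and "\<And>k t. k < n \<Longrightarrow> t \<in> {c..d} \<Longrightarrow> (F k has_vector_derivative F (Suc k) t) (at t within {c..d})"
    and "\<And>t. t \<in> {c..d} \<Longrightarrow> f t = F 0 t"
    and "k \<le> n" "t \<in> {c..d}"
  shows "nth_deriv {c..d} k f t = F k t"
  using assms(4,5)
proof (induction k arbitrary: t)
  case 0
  then show ?case using assms(3) by simp
next
  case (Suc k)
  have "(nth_deriv {c..d} k f has_vector_derivative F (Suc k) t) (at t within {c..d})"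
    by (rule has_vector_derivative_transform[OF Suc.prems(2) _ assms(2)]) (use Suc in auto)
  then show ?case using assms(1) Suc.prems by (simp add: vderiv_within_Icc)
qed

lemma C_on_chain:
  assumes "c < d"
    and "\<And>k t. k < n \<Longrightarrow> t \<in> {c..d} \<Longrightarrow> (F k has_vector_derivative F (Suc k) t) (at t within {c..d})"
    and "\<And>t. t \<in> {c..d} \<Longrightarrow> f t = F 0 t"
    and "continuous_on {c..d} (F n)"
  shows "C_on n {c..d} f"
  unfolding C_on_def
proof (intro conjI allI impI ballI)
  fix k t assume kt: "k < n" "t \<in> {c..d}"
  have "(nth_deriv {c..d} k f has_vector_derivative F (Suc k) t) (at t within {c..d})"
    by (rule has_vector_derivative_transform[OF kt(2) _ assms(2)[OF kt]])
       (use kt nth_deriv_chain[OF assms(1-3), of k] in auto)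
  then show "nth_deriv {c..d} k f differentiable (at t within {c..d})"
    by (rule differentiableI_vector)
next
  show "continuous_on {c..d} (nth_deriv {c..d} n f)"
    using assms(4) by (rule continuous_on_eq) (use nth_deriv_chain[OF assms(1-3) order_refl] in auto)
qed

lemma C_on_has_vector_derivative:
  assumes "C_on n S f" "k < n" "t \<in> S"
  shows "(nth_deriv S k f has_vector_derivative nth_deriv S (Suc k) f t) (at t within S)"
  using assms by (auto simp: C_on_def vector_derivative_works)

lemma C_on_continuous_nth_deriv:
  assumes "C_on n S f" "k \<le> n"
  shows "continuous_on S (nth_deriv S k f)"
proof (cases "k = n")
  case False
  then show ?thesis using assms
    by (auto simp: C_on_def continuous_on_eq_continuous_within intro!: differentiable_imp_continuous_within)
qed (use assms in \<open>auto simp: C_on_def\<close>)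

text \<open>A function with coefficient 0 contributes the zero function whatever its regularity, so
  differentiability is asked only for nonzero coefficients; this matches the hypotheses on the
  components of \<gamma>. Existence and value go through one induction because the step needs both
  at nearby points.\<close>

lemma nth_deriv_lincomb:
  assumes "c < d" "t \<in> {c..d}"
    and "p \<noteq> 0 \<Longrightarrow> nth_differentiable_at {c..d} k f t"
    and "q \<noteq> 0 \<Longrightarrow> nth_differentiable_at {c..d} k g t"
  shows "nth_differentiable_at {c..d} k (\<lambda>t. p * f t + q * g t) t \<and>
         nth_deriv {c..d} k (\<lambda>t. p * f t + q * g t) t
           = p * nth_deriv {c..d} k f t + q * nth_deriv {c..d} k g t"
  using assms(2-4)
proof (induction k arbitrary: t)
  case 0
  then show ?case by simp
next
  case (Suc k)
  let ?S = "{c..d}" and ?h = "\<lambda>t. p * f t + q * g t"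
  let ?h' = "\<lambda>s. p * nth_deriv ?S k f s + q * nth_deriv ?S k g s"
  have at: "nth_differentiable_at ?S k ?h t" "nth_deriv ?S k ?h t = ?h' t"
    using Suc by auto
  have S: "\<forall>\<^sub>F s in at t within ?S. s \<in> ?S"
    by (simp add: eventually_at_topological) blast
  have evf: "\<forall>\<^sub>F s in at t within ?S. p \<noteq> 0 \<longrightarrow> nth_differentiable_at ?S k f s"
    using Suc.prems by (cases "p = 0") auto
  have evg: "\<forall>\<^sub>F s in at t within ?S. q \<noteq> 0 \<longrightarrow> nth_differentiable_at ?S k g s"
    using Suc.prems by (cases "q = 0") auto
  \<comment> \<open>A derivative at t sees only values near t, so the induction hypothesis is used
    at all points of the interval close to t.\<close>
  have ev: "\<forall>\<^sub>F s in at t within ?S. nth_differentiable_at ?S k ?h s \<and> nth_deriv ?S k ?h s = ?h' s"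
    using S evf evg by eventually_elim (use Suc.IH in auto)
  have df: "((\<lambda>s. p * nth_deriv ?S k f s) has_vector_derivative p * nth_deriv ?S (Suc k) f t) (at t within ?S)"
    using Suc.prems by (cases "p = 0") (auto simp: vector_derivative_works intro!: derivative_eq_intros)
  have dg: "((\<lambda>s. q * nth_deriv ?S k g s) has_vector_derivative q * nth_deriv ?S (Suc k) g t) (at t within ?S)"
    using Suc.prems by (cases "q = 0") (auto simp: vector_derivative_works intro!: derivative_eq_intros)
  have "(nth_deriv ?S k ?h has_vector_derivative
      p * nth_deriv ?S (Suc k) f t + q * nth_deriv ?S (Suc k) g t) (at t within ?S)"
    using has_vector_derivative_add[OF df dg]
    unfolding has_vector_derivative_def
    by (rule has_derivative_transform_eventually) (use ev Suc.prems at in \<open>simp_all add: eventually_mono\<close>)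
  moreover have "\<forall>\<^sub>F s in at t within ?S. nth_differentiable_at ?S k ?h s"
    using ev by (rule eventually_mono) simp
  ultimately show ?case
    using at Suc.prems(1) assms(1) by (simp add: vderiv_within_Icc differentiableI_vector)
qed

text \<open>\<open>aI\<close> is differentiated relative to \<open>{a..b}\<close>, whereas the
  costates live on \<open>{a..T}\<close> and \<open>{T..b}\<close>; at T a two-sided derivative has
  to be read as a one-sided one.\<close>

lemma nth_deriv_subinterval:
  assumes "c < d" "{c..d} \<subseteq> {a..b}" "t \<in> {c..d}" "nth_differentiable_at {a..b} k f t"
  shows "nth_differentiable_at {c..d} k f t \<and> nth_deriv {c..d} k f t = nth_deriv {a..b} k f t"
  using assms(3,4)
proof (induction k arbitrary: t)
  case 0
  then show ?case by simp
next
  case (Suc k)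
  have at: "nth_differentiable_at {c..d} k f t" "nth_deriv {c..d} k f t = nth_deriv {a..b} k f t"
    using Suc by auto
  have S: "\<forall>\<^sub>F s in at t within {c..d}. s \<in> {c..d}"
    by (simp add: eventually_at_topological) blast
  have "\<forall>\<^sub>F s in at t within {c..d}. nth_differentiable_at {a..b} k f s"
    using Suc.prems at_le[OF assms(2)] by (auto intro: filter_leD)
  with S have ev: "\<forall>\<^sub>F s in at t within {c..d}.
      nth_differentiable_at {c..d} k f s \<and> nth_deriv {c..d} k f s = nth_deriv {a..b} k f s"
    by eventually_elim (use Suc.IH in auto)
  have "(nth_deriv {a..b} k f has_vector_derivative nth_deriv {a..b} (Suc k) f t) (at t within {c..d})"
    using Suc.prems by (auto simp: vector_derivative_works intro: has_vector_derivative_within_subset[OF _ assms(2)])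
  then have "(nth_deriv {c..d} k f has_vector_derivative nth_deriv {a..b} (Suc k) f t) (at t within {c..d})"
    unfolding has_vector_derivative_def
    by (rule has_derivative_transform_eventually) (use ev Suc.prems at in \<open>simp_all add: eventually_mono\<close>)
  moreover have "\<forall>\<^sub>F s in at t within {c..d}. nth_differentiable_at {c..d} k f s"
    using ev by (rule eventually_mono) simp
  ultimately show ?case
    using at Suc.prems(1) assms(1) by (simp add: vderiv_within_Icc differentiableI_vector)
qed

text \<open>Differentiability of order i - k at t includes differentiability of order i - (k + 1) at
  all nearby points. So the formula for \<open>e (Suc k)\<close> holds in a neighbourhood and may be
  differentiated at t; comparison with the differential equation of \<open>e (Suc k)\<close> then
  gives \<open>e k t\<close>.\<close>

lemma backward_chain_formula:
  assumes "c < d"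
    and "\<And>t. t \<in> {c..d} \<Longrightarrow> e (Suc n) t = 0"
    and "\<And>k t. k \<le> n \<Longrightarrow> t \<in> {c..d} \<Longrightarrow>
      (e (Suc k) has_vector_derivative - (N k t + e k t)) (at t within {c..d})"
    and "k \<le> Suc n" "t \<in> {c..d}"
    and "\<And>i. i \<in> {k..n} \<Longrightarrow> nth_differentiable_at {c..d} (i - k) (N i) t"
  shows "e k t = - (\<Sum>i=k..n. (-1)^(i-k) * nth_deriv {c..d} (i - k) (N i) t)"
  using assms(4-6)
proof (induction k arbitrary: t rule: inc_induct)
  case base
  then show ?case using assms(2) by simp
next
  case (step k)
  let ?S = "{c..d}"
  let ?r = "\<lambda>s. - (\<Sum>i=Suc k..n. (-1)^(i-Suc k) * nth_deriv ?S (i - Suc k) (N i) s)"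
  have diff: "nth_differentiable_at ?S (Suc (i - Suc k)) (N i) t" if "i \<in> {Suc k..n}" for i
    using step.prems(2)[of i] that by (simp add: Suc_diff_Suc)
  have at: "e (Suc k) t = ?r t"
    using diff by (intro step.IH[OF step.prems(1)]) auto
  have "\<forall>\<^sub>F s in at t within ?S. \<forall>i\<in>{Suc k..n}. nth_differentiable_at ?S (i - Suc k) (N i) s"
    using diff by (intro eventually_ball_finite) auto
  moreover have "\<forall>\<^sub>F s in at t within ?S. s \<in> ?S"
    by (simp add: eventually_at_topological) blast
  ultimately have ev: "\<forall>\<^sub>F s in at t within ?S. e (Suc k) s = ?r s"
    by eventually_elim (use step.IH in auto)
  have "(?r has_vector_derivative
      - (\<Sum>i=Suc k..n. (-1)^(i-Suc k) * nth_deriv ?S (Suc (i - Suc k)) (N i) t)) (at t within ?S)"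
    using diff by (intro has_vector_derivative_minus has_vector_derivative_sum has_vector_derivative_mult_right)
      (simp add: vector_derivative_works)
  then have "(e (Suc k) has_vector_derivative
      - (\<Sum>i=Suc k..n. (-1)^(i-Suc k) * nth_deriv ?S (Suc (i - Suc k)) (N i) t)) (at t within ?S)"
    unfolding has_vector_derivative_def
    by (rule has_derivative_transform_eventually) (use ev step.prems at in \<open>auto elim: eventually_mono\<close>)
  moreover have "(e (Suc k) has_vector_derivative - (N k t + e k t)) (at t within ?S)"
    using assms(3)[of k t] step by simp
  \<comment> \<open>Two derivatives of \<open>e (Suc k)\<close> at the same point of a nondegenerate
    interval coincide.\<close>
  ultimately have "N k t + e k t = (\<Sum>i=Suc k..n. (-1)^(i-Suc k) * nth_deriv ?S (Suc (i - Suc k)) (N i) t)"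
    using assms(1) step.prems(1) by (metis vderiv_within_Icc neg_equal_iff_equal)
  also have "\<dots> = - (\<Sum>i=Suc k..n. (-1)^(i-k) * nth_deriv ?S (i - k) (N i) t)"
    unfolding sum_negf[symmetric]
  proof (intro sum.cong refl)
    fix i assume "i \<in> {Suc k..n}"
    then have "i - k = Suc (i - Suc k)" by auto
    then show "(-1)^(i-Suc k) * nth_deriv ?S (Suc (i - Suc k)) (N i) t =
        - ((-1)^(i-k) * nth_deriv ?S (i - k) (N i) t)"
      by simp
  qed
  finally show ?case
    using step.hyps by (simp add: sum.atLeast_Suc_atMost algebra_simps)
qed

subsection \<open>A variational lemma with free right end\<close>

definition antideriv :: "real \<Rightarrow> (real \<Rightarrow> real) \<Rightarrow> real \<Rightarrow> real" where
  "antideriv a g t = integral {a..t} g"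

lemma antideriv_has_vector_derivative:
  assumes "continuous_on {a..b} g" "t \<in> {a..b}"
  shows "(antideriv a g has_vector_derivative g t) (at t within {a..b})"
  unfolding antideriv_def using assms by (rule integral_has_vector_derivative)

lemma continuous_on_antideriv:
  assumes "continuous_on {a..b} g"
  shows "continuous_on {a..b} (antideriv a g)"
  using antideriv_has_vector_derivative[OF assms]
  by (intro continuous_on_vector_derivative)

lemma continuous_on_antideriv_pow:
  assumes "continuous_on {a..b} g"
  shows "continuous_on {a..b} ((antideriv a ^^ k) g)"
  by (induction k) (auto intro: continuous_on_antideriv assms)

lemma antideriv_at_base [simp]: "antideriv a g a = 0"
  by (simp add: antideriv_def)

text \<open>The costates: the solution of e' = - (N + previous e) that starts from 0 and has
  prescribed values at the right end d. \<open>J k\<close> is the end value of the entry with index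
  k + 1.\<close>

primrec tail_seq :: "real \<Rightarrow> (nat \<Rightarrow> real \<Rightarrow> real) \<Rightarrow> (nat \<Rightarrow> real) \<Rightarrow> nat \<Rightarrow> real \<Rightarrow> real" where
  "tail_seq d N J 0 = (\<lambda>s. 0)"
| "tail_seq d N J (Suc k) = (\<lambda>s. J k + integral {s..d} (\<lambda>t. N k t + tail_seq d N J k t))"

lemma tail_seq_at_end [simp]: "tail_seq d N J (Suc k) d = J k"
  by simp

lemma continuous_on_tail_seq:
  assumes "\<And>i. i < k \<Longrightarrow> continuous_on {c..d} (N i)"
  shows "continuous_on {c..d} (tail_seq d N J k)"
  using assms
proof (induction k)
  case (Suc k)
  then have "continuous_on {c..d} (\<lambda>t. N k t + tail_seq d N J k t)"
    by (intro continuous_intros) auto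
  then have "continuous_on {c..d} (\<lambda>s. integral {s..d} (\<lambda>t. N k t + tail_seq d N J k t))"
    using integral_has_vector_derivative'[of c d "\<lambda>t. N k t + tail_seq d N J k t"]
    by (intro continuous_on_vector_derivative)
  then show ?case unfolding tail_seq.simps by (intro continuous_intros)
qed simp

lemma tail_seq_has_vector_derivative:
  assumes "\<And>i. i \<le> k \<Longrightarrow> continuous_on {c..d} (N i)" "t \<in> {c..d}"
  shows "(tail_seq d N J (Suc k) has_vector_derivative - (N k t + tail_seq d N J k t)) (at t within {c..d})"
proof -
  have "continuous_on {c..d} (\<lambda>t. N k t + tail_seq d N J k t)"
    by (intro continuous_intros continuous_on_tail_seq assms(1)) auto
  from integral_has_vector_derivative'[OF this assms(2)]
  show ?thesis by (auto intro!: derivative_eq_intros)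
qed

text \<open>One step of trading a primitive of the variation for a primitive of the coefficient. The
  primitive starts at a even when the integral starts at c, so the lower boundary term vanishes only
  for c = a.\<close>

lemma antideriv_by_parts:
  assumes w: "continuous_on {a..b} w" and sub: "{c..d} \<subseteq> {a..b}" and "c \<le> d"
    and P: "continuous_on {c..d} P"
    and p: "\<And>t. t \<in> {c..d} \<Longrightarrow> (p has_vector_derivative - P t) (at t within {c..d})"
  shows "integral {c..d} (\<lambda>t. antideriv a w t * P t) =
    integral {c..d} (\<lambda>t. w t * p t) - antideriv a w d * p d + antideriv a w c * p c"
proof -
  have cp: "continuous_on {c..d} p"
    using p by (rule continuous_on_vector_derivative)
  have cV: "continuous_on {c..d} (antideriv a w)" "continuous_on {c..d} w"
    using continuous_on_antideriv[OF w] w sub by (auto intro: continuous_on_subset)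
  have "((\<lambda>t. antideriv a w t * - P t + w t * p t) has_integral
      antideriv a w d * p d - antideriv a w c * p c) {c..d}"
  proof (rule fundamental_theorem_of_calculus[OF \<open>c \<le> d\<close>])
    fix t assume t: "t \<in> {c..d}"
    have "(antideriv a w has_vector_derivative w t) (at t within {c..d})"
      using antideriv_has_vector_derivative[OF w] t sub
      by (meson has_vector_derivative_within_subset subsetD)
    then show "((\<lambda>t. antideriv a w t * p t) has_vector_derivative
      antideriv a w t * - P t + w t * p t) (at t within {c..d})"
      using has_vector_derivative_mult[OF _ p[OF t]] by blast
  qed
  then have "integral {c..d} (\<lambda>t. w t * p t - antideriv a w t * P t) =
     antideriv a w d * p d - antideriv a w c * p c"
    by (simp add: integral_unique)
  moreover have "integral {c..d} (\<lambda>t. w t * p t - antideriv a w t * P t) =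
     integral {c..d} (\<lambda>t. w t * p t) - integral {c..d} (\<lambda>t. antideriv a w t * P t)"
    by (intro integral_diff integrable_continuous_real continuous_intros cp cV P)
  ultimately show ?thesis by simp
qed

text \<open>A du Bois-Reymond lemma of order n with coefficients that may jump at T. The function
  \<open>N n + e n\<close> need not be continuous across T and cannot be used as a test function;
  its primitive, of index n + 1, can, and this is why the costates go one index beyond n. Boundary
  terms vanish at a because primitives vanish there, and at b because \<open>er\<close>
  does.\<close>

lemma free_end_variation:
  fixes Nl Nr :: "nat \<Rightarrow> real \<Rightarrow> real"
  assumes aTb: "a < T" "T < b" and n: "n \<ge> 1"
    and Nl: "\<And>i. i \<le> n \<Longrightarrow> continuous_on {a..T} (Nl i)"
    and Nr: "\<And>i. i \<le> n \<Longrightarrow> continuous_on {T..b} (Nr i)"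
    and var: "\<And>g. continuous_on {a..b} g \<Longrightarrow>
       (\<Sum>i\<le>n. integral {a..T} (\<lambda>t. (antideriv a ^^ (n-i)) g t * Nl i t)
             + integral {T..b} (\<lambda>t. (antideriv a ^^ (n-i)) g t * Nr i t))
       + c * (antideriv a ^^ n) g T = 0"
  obtains el er where
    "\<And>k t. k \<le> n \<Longrightarrow> t \<in> {a..T} \<Longrightarrow>
        (el (Suc k) has_vector_derivative - (Nl k t + el k t)) (at t within {a..T})"
    "\<And>k t. k \<le> n \<Longrightarrow> t \<in> {T..b} \<Longrightarrow>
        (er (Suc k) has_vector_derivative - (Nr k t + er k t)) (at t within {T..b})"
    "\<And>t. t \<in> {a..T} \<Longrightarrow> el (Suc n) t = 0" "\<And>t. t \<in> {T..b} \<Longrightarrow> er (Suc n) t = 0"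
    "\<And>t. el 0 t = 0" "\<And>t. er 0 t = 0" "\<And>k. er k b = 0"
    "el 1 T = er 1 T + c" "\<And>k. k \<ge> 2 \<Longrightarrow> el k T = er k T"
proof -
  define er where "er = tail_seq b Nr (\<lambda>_. 0)"
  \<comment> \<open>The end values of \<open>el\<close> are chosen so that the boundary terms at \<open>T\<close> cancel.\<close>
  define el where "el = tail_seq T Nl (\<lambda>k. er (Suc k) T + (if k = 0 then c else 0))"
  let ?V = "\<lambda>k g. (antideriv a ^^ k) g"
  have cel: "continuous_on {a..T} (el k)" if "k \<le> Suc n" for k
    unfolding el_def using that by (intro continuous_on_tail_seq Nl) auto
  have cer: "continuous_on {T..b} (er k)" if "k \<le> Suc n" for k
    unfolding er_def using that by (intro continuous_on_tail_seq Nr) auto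
  have del: "(el (Suc k) has_vector_derivative - (Nl k t + el k t)) (at t within {a..T})"
    if "k \<le> n" "t \<in> {a..T}" for k t
    unfolding el_def using that by (intro tail_seq_has_vector_derivative Nl) auto
  have der: "(er (Suc k) has_vector_derivative - (Nr k t + er k t)) (at t within {T..b})"
    if "k \<le> n" "t \<in> {T..b}" for k t
    unfolding er_def using that by (intro tail_seq_has_vector_derivative Nr) auto
  have erb: "er k b = 0" for k
    by (cases k) (simp_all add: er_def)
  have jump: "el (Suc k) T = er (Suc k) T + (if k = 0 then c else 0)" for k
    unfolding el_def by (rule tail_seq_at_end)

  \<comment> \<open>Invariant after m integrations by parts: the coefficients below m have been
    absorbed into \<open>el m\<close> and \<open>er m\<close>. The variation is a primitive of order
    n + 1 of u, that is, g is the primitive of u. The cost c appears from m = 1 on, since it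
    multiplies the top primitive, whose boundary term arises in the first step.\<close>
  have partial: "(\<Sum>i<m. integral {a..T} (\<lambda>t. ?V (Suc n - i) u t * Nl i t)
             + integral {T..b} (\<lambda>t. ?V (Suc n - i) u t * Nr i t))
       + (if m = 0 then 0 else c * ?V (Suc n) u T)
     = integral {a..T} (\<lambda>t. ?V (Suc n - m) u t * el m t)
       + integral {T..b} (\<lambda>t. ?V (Suc n - m) u t * er m t)"
    if u: "continuous_on {a..b} u" and "m \<le> Suc n" for u m
    using that(2)
  proof (induction m)
    case 0
    then show ?case by (simp add: el_def er_def)
  next
    case (Suc m)
    define w where "w = ?V (n - m) u"
    have Vw: "?V (Suc n - m) u = antideriv a w"
      using Suc.prems by (simp add: w_def Suc_diff_le)
    have w: "continuous_on {a..b} w"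
      unfolding w_def by (rule continuous_on_antideriv_pow[OF u])
    have cV: "continuous_on {a..T} (antideriv a w)" "continuous_on {T..b} (antideriv a w)"
      using continuous_on_antideriv[OF w] aTb by (auto elim: continuous_on_subset)
    have m: "m \<le> n" using Suc.prems by simp
    have "integral {a..T} (\<lambda>t. antideriv a w t * (Nl m t + el m t)) =
        integral {a..T} (\<lambda>t. w t * el (Suc m) t) - antideriv a w T * el (Suc m) T
          + antideriv a w a * el (Suc m) a"
      using aTb m by (intro antideriv_by_parts[OF w] del continuous_intros Nl cel) auto
    moreover have "integral {T..b} (\<lambda>t. antideriv a w t * (Nr m t + er m t)) =
        integral {T..b} (\<lambda>t. w t * er (Suc m) t) - antideriv a w b * er (Suc m) b
          + antideriv a w T * er (Suc m) T"
      using aTb m by (intro antideriv_by_parts[OF w] der continuous_intros Nr cer) auto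
    moreover have "integral {a..T} (\<lambda>t. antideriv a w t * (Nl m t + el m t)) =
        integral {a..T} (\<lambda>t. antideriv a w t * Nl m t) + integral {a..T} (\<lambda>t. antideriv a w t * el m t)"
      unfolding distrib_left using m
      by (intro integral_add integrable_continuous_real continuous_intros Nl cel cV) auto
    moreover have "integral {T..b} (\<lambda>t. antideriv a w t * (Nr m t + er m t)) =
        integral {T..b} (\<lambda>t. antideriv a w t * Nr m t) + integral {T..b} (\<lambda>t. antideriv a w t * er m t)"
      unfolding distrib_left using m
      by (intro integral_add integrable_continuous_real continuous_intros Nr cer cV) auto
    moreover have "(if m = 0 then 0 else c * ?V (Suc n) u T) + antideriv a w T * (if m = 0 then c else 0)
        = c * ?V (Suc n) u T"
      by (simp add: w_def)
    moreover have "antideriv a w b * er (Suc m) b = 0" "antideriv a w a * el (Suc m) a = 0"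
      "antideriv a w T * el (Suc m) T = antideriv a w T * er (Suc m) T + antideriv a w T * (if m = 0 then c else 0)"
      by (simp_all only: erb jump antideriv_at_base mult_zero_left mult_zero_right distrib_left)
    moreover have "(\<Sum>i<m. integral {a..T} (\<lambda>t. ?V (Suc n - i) u t * Nl i t)
             + integral {T..b} (\<lambda>t. ?V (Suc n - i) u t * Nr i t))
       + (if m = 0 then 0 else c * ?V (Suc n) u T)
     = integral {a..T} (\<lambda>t. antideriv a w t * el m t)
       + integral {T..b} (\<lambda>t. antideriv a w t * er m t)"
      using Suc.IH Suc.prems unfolding Vw by simp
    ultimately have "(\<Sum>i<m. integral {a..T} (\<lambda>t. ?V (Suc n - i) u t * Nl i t)
             + integral {T..b} (\<lambda>t. ?V (Suc n - i) u t * Nr i t))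
       + (integral {a..T} (\<lambda>t. antideriv a w t * Nl m t) + integral {T..b} (\<lambda>t. antideriv a w t * Nr m t))
       + c * ?V (Suc n) u T
     = integral {a..T} (\<lambda>t. w t * el (Suc m) t) + integral {T..b} (\<lambda>t. w t * er (Suc m) t)"
      by linarith
    then show ?case
      unfolding sum.lessThan_Suc Vw diff_Suc_Suc w_def[symmetric] by simp
  qed

  \<comment> \<open>Testing with the primitive of \<open>z\<close> turns the variation into the integral of \<open>z\<^sup>2\<close>.\<close>
  define z where "z = (\<lambda>t. if t \<le> T then el (Suc n) t else er (Suc n) t)"
  have z: "continuous_on {a..b} z"
  proof -
    \<comment> \<open>The only jump is at index 1, and n + 1 is larger than 1 because n is at least
      1.\<close>
    have "continuous_on ({a..T} \<union> {T..b}) z" unfolding z_def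
    proof (rule continuous_on_cases)
      show "\<forall>t. t \<in> {a..T} \<and> \<not> t \<le> T \<or> t \<in> {T..b} \<and> t \<le> T \<longrightarrow> el (Suc n) t = er (Suc n) t"
        using n jump[of n] by (auto dest: order.antisym)
    qed (use cel cer in auto)
    then show ?thesis using aTb by (simp add: ivl_disj_un_two_touch)
  qed
  have zr: "z t = er (Suc n) t" if "t \<in> {T..b}" for t
    using that n jump[of n] by (cases "t = T") (auto simp: z_def)
  have "integral {a..T} (\<lambda>t. z t * el (Suc n) t) + integral {T..b} (\<lambda>t. z t * er (Suc n) t) = 0"
  proof -
    have "?V (Suc n - i) z = ?V (n - i) (antideriv a z)" if "i \<le> n" for i
      using that by (simp add: Suc_diff_le funpow_swap1)
    then have "(\<Sum>i\<le>n. integral {a..T} (\<lambda>t. ?V (Suc n - i) z t * Nl i t)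
             + integral {T..b} (\<lambda>t. ?V (Suc n - i) z t * Nr i t)) + c * ?V (Suc n) z T = 0"
      using var[OF continuous_on_antideriv[OF z]] by (simp add: funpow_swap1)
    then show ?thesis
      using partial[OF z order_refl] by (simp only: lessThan_Suc_atMost) simp
  qed
  moreover have "integral {a..T} (\<lambda>t. z t * el (Suc n) t) = integral {a..T} (\<lambda>t. z t * z t)"
    by (intro integral_cong) (simp add: z_def)
  moreover have "integral {T..b} (\<lambda>t. z t * er (Suc n) t) = integral {T..b} (\<lambda>t. z t * z t)"
    by (intro integral_cong) (simp add: zr)
  moreover have "integral {a..T} (\<lambda>t. z t * z t) + integral {T..b} (\<lambda>t. z t * z t) = integral {a..b} (\<lambda>t. z t * z t)"
    using aTb by (intro Henstock_Kurzweil_Integration.integral_combine integrable_continuous_real continuous_intros z) auto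
  ultimately have "integral {a..b} (\<lambda>t. z t * z t) = 0" by simp
  moreover have "continuous_on {a..b} (\<lambda>t. z t * z t)"
    by (intro continuous_intros z)
  ultimately have z0: "z t = 0" if "t \<in> {a..b}" for t
    using integral_eq_0_iff[of a b "\<lambda>t. z t * z t"] aTb that by simp
  show ?thesis
  proof (rule that[of el er])
    show "el (Suc n) t = 0" if "t \<in> {a..T}" for t
      using z0[of t] that aTb by (auto simp: z_def)
    show "er (Suc n) t = 0" if "t \<in> {T..b}" for t
      using z0[of t] zr[of t] that aTb by auto
    show "el 1 T = er 1 T + c" using jump[of 0] by simp
    show "el k T = er k T" if "k \<ge> 2" for k
      using jump[of "k-1"] that by (cases k) auto
  qed (use del der erb in \<open>auto simp: el_def er_def\<close>)
qed

subsection \<open>Calculus on the slab\<close>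

lemma in_slab_update:
  assumes "v \<in> slab a b m" "k \<in> {1..m}"
  shows "v(k := s) \<in> slab a b m \<longleftrightarrow> (k = 1 \<longrightarrow> s \<in> {a..b})"
proof -
  have "v 1 \<in> {a..b}" "\<forall>l. l \<notin> {1..m} \<longrightarrow> v l = 0"
    using assms(1) unfolding slab_def by simp_all
  then show ?thesis
    using assms(2) unfolding slab_def mem_Collect_eq by (metis fun_upd_apply)
qed

lemma slab_section:
  assumes "v \<in> slab a b m" "k \<in> {1..m}"
  shows "{s. v(k := s) \<in> slab a b m} = (if k = 1 then {a..b} else UNIV)"
  unfolding in_slab_update[OF assms] by auto

lemma C1_slab_partial_deriv:
  assumes F: "C1_slab a b m F" and v: "v \<in> slab a b m" and k: "k \<in> {1..m}"
  shows "((\<lambda>s. F (v(k := s))) has_vector_derivative partial_deriv (slab a b m) k F v)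
           (at (v k) within {s. v(k := s) \<in> slab a b m})"
proof -
  have "\<forall>v\<in>slab a b m. (\<lambda>s. F (v(k := s))) differentiable
            (at (v k) within {s. v(k := s) \<in> slab a b m})"
    using bspec[OF F[unfolded C1_slab_def] k] by (rule conjunct1)
  from bspec[OF this v] show ?thesis
    unfolding partial_deriv_def vector_derivative_works .
qed

lemma partial_deriv_mean_value:
  assumes F: "C1_slab a b m F" and k: "k \<in> {1..m}"
    and u: "u \<in> slab a b m" "u(k := y) \<in> slab a b m"
  obtains s where "s \<in> closed_segment (u k) y" "u(k := s) \<in> slab a b m"
    "F (u(k := y)) - F u = (y - u k) * partial_deriv (slab a b m) k F (u(k := s))"
proof -
  let ?S = "{s. u(k := s) \<in> slab a b m}"
  let ?D = "\<lambda>s. partial_deriv (slab a b m) k F (u(k := s))"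
  have S: "?S = (if k = 1 then {a..b} else UNIV)" by (rule slab_section[OF u(1) k])
  have uk: "u k \<in> ?S" "y \<in> ?S" using u by simp_all
  have "convex ?S" unfolding S by simp
  with uk have seg: "closed_segment (u k) y \<subseteq> ?S"
    by (intro closed_segment_subset)
  have d: "((\<lambda>s. F (u(k := s))) has_derivative (\<lambda>h. h * ?D s)) (at s within T)"
    if "s \<in> T" "T \<subseteq> ?S" for s T
  proof -
    have us: "u(k := s) \<in> slab a b m" using that by auto
    have "((\<lambda>r. F (u(k := r))) has_vector_derivative ?D s) (at s within ?S)"
      using C1_slab_partial_deriv[OF F us k] by simp
    then have "((\<lambda>r. F (u(k := r))) has_derivative (\<lambda>h. h * ?D s)) (at s within ?S)"
      by (simp add: has_vector_derivative_def)
    then show ?thesis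
      by (rule has_derivative_subset) (rule that(2))
  qed
  \<comment> \<open>The mean value theorem is applied on an ordered interval; exchanging the end
    points changes the sign of both sides.\<close>
  define l r where "l = min (u k) y" and "r = max (u k) y"
  have lr: "l \<le> r" and cs: "closed_segment (u k) y = {l..r}"
    by (auto simp: l_def r_def closed_segment_eq_real_ivl)
  have "\<exists>s\<in>{l..r}. F (u(k := r)) - F (u(k := l)) = (r - l) * ?D s"
    using seg unfolding cs by (intro mvt_very_simple[OF lr] d) simp_all
  then obtain s where s: "s \<in> {l..r}" and eq: "F (u(k := r)) - F (u(k := l)) = (r - l) * ?D s" ..
  show ?thesis
  proof (rule that[of s])
    show seg_s: "s \<in> closed_segment (u k) y" unfolding cs by (rule s)
    show "u(k := s) \<in> slab a b m" using subsetD[OF seg seg_s] by simp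
    show "F (u(k := y)) - F u = (y - u k) * ?D s"
    proof (cases "u k \<le> y")
      case True
      then have "l = u k" "r = y" by (simp_all add: l_def r_def)
      with eq show ?thesis by simp
    next
      case False
      then have "l = y" "r = u k" by (simp_all add: l_def r_def)
      with eq have "- (F (u(k := y)) - F u) = - ((y - u k) * ?D s)"
        by (simp add: left_diff_distrib)
      then show ?thesis by (simp only: neg_equal_iff_equal)
    qed
  qed
qed

text \<open>Change the coordinates one at a time and apply the mean value theorem to each of them.\<close>

lemma slab_mean_value:
  assumes F: "C1_slab a b m F" and v: "v \<in> slab a b m" and w: "w \<in> slab a b m"
  shows "\<exists>\<xi>. (\<forall>k. \<xi> k \<in> slab a b m \<and> (\<forall>l. \<xi> k l \<in> closed_segment (v l) (w l))) \<and>
    F w - F v = (\<Sum>k=1..m. (w k - v k) * partial_deriv (slab a b m) k F (\<xi> k))"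
proof -
  \<comment> \<open>The corners of the path from v to w. Index 0 and the indices above m carry 0 in
    both points, so \<open>z 0\<close> is v and \<open>z m\<close> is w.\<close>
  define z where "z j = (\<lambda>l. if l \<le> j then w l else v l)" for j :: nat
  have v1: "v 1 \<in> {a..b}" "\<And>l. l \<notin> {1..m} \<Longrightarrow> v l = 0"
    and w1: "w 1 \<in> {a..b}" "\<And>l. l \<notin> {1..m} \<Longrightarrow> w l = 0"
    using v w unfolding slab_def mem_Collect_eq by blast+
  have z: "z j \<in> slab a b m" for j
    unfolding slab_def z_def mem_Collect_eq using v1 w1 by presburger
  have "z 0 l = v l" for l
    using v1(2)[of l] w1(2)[of l] by (cases "l = 0") (simp_all add: z_def)
  then have z0: "z 0 = v" by blast
  have "z m l = w l" for l
    using v1(2)[of l] w1(2)[of l] by (cases "l \<le> m") (simp_all add: z_def)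
  then have zm: "z m = w" by blast
  have zS: "z (Suc j) = (z j)(Suc j := w (Suc j))" for j
    by (auto simp: z_def fun_eq_iff le_Suc_eq)
  have "\<exists>\<eta>. \<eta> \<in> slab a b m \<and> (\<forall>l. \<eta> l \<in> closed_segment (v l) (w l)) \<and>
      F (z k) - F (z (k-1)) = (w k - v k) * partial_deriv (slab a b m) k F \<eta>" if k: "k \<in> {1..m}" for k
  proof -
    have zk: "z k = (z (k-1))(k := w k)" using zS[of "k-1"] k by simp
    have zkk: "z (k-1) k = v k" using k by (auto simp: z_def)
    obtain s where s: "s \<in> closed_segment (v k) (w k)" "(z (k-1))(k := s) \<in> slab a b m"
        "F (z k) - F (z (k-1)) = (w k - v k) * partial_deriv (slab a b m) k F ((z (k-1))(k := s))"
      using partial_deriv_mean_value[OF F k, of "z (k-1)" "w k"] z[of "k-1"] z[of k]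
      unfolding zk[symmetric] zkk by auto
    then show ?thesis
      by (intro exI[of _ "(z (k-1))(k := s)"]) (auto simp: z_def)
  qed
  then have "\<forall>k\<in>{1..m}. \<exists>\<eta>. \<eta> \<in> slab a b m \<and> (\<forall>l. \<eta> l \<in> closed_segment (v l) (w l)) \<and>
      F (z k) - F (z (k-1)) = (w k - v k) * partial_deriv (slab a b m) k F \<eta>"
    by (rule ballI)
  from bchoice[OF this] obtain \<xi> where \<xi>: "\<forall>k\<in>{1..m}. \<xi> k \<in> slab a b m \<and> (\<forall>l. \<xi> k l \<in> closed_segment (v l) (w l)) \<and>
      F (z k) - F (z (k-1)) = (w k - v k) * partial_deriv (slab a b m) k F (\<xi> k)"
    by (rule exE)
  have "F w - F v = (\<Sum>k=1..m. F (z k) - F (z (k-1)))"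
    using sum_telescope''[of 0 m "\<lambda>k. F (z k)"] z0 zm
    by (cases "m = 0") (auto simp: atLeastSucAtMost_greaterThanAtMost)
  also have "\<dots> = (\<Sum>k=1..m. (w k - v k) * partial_deriv (slab a b m) k F (\<xi> k))"
    using \<xi> by (intro sum.cong refl) blast
  \<comment> \<open>Outside \<open>{1..m}\<close> the point v fills in, so that the claim can
    quantify over all indices.\<close>
  also have "\<dots> = (\<Sum>k=1..m. (w k - v k) * partial_deriv (slab a b m) k F (if k \<in> {1..m} then \<xi> k else v))"
    by (intro sum.cong) simp_all
  finally show ?thesis
    using \<xi> v by (intro exI[of _ "\<lambda>k. if k \<in> {1..m} then \<xi> k else v"] conjI allI) simp_all
qed

lemma tendsto_partial_deriv:
  assumes F: "C1_slab a b m F" and k: "k \<in> {1..m}" and v: "v \<in> slab a b m"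
    and p: "\<And>l. ((\<lambda>x. p x l) \<longlongrightarrow> v l) X" and "\<forall>\<^sub>F x in X. p x \<in> slab a b m"
  shows "((\<lambda>x. partial_deriv (slab a b m) k F (p x)) \<longlongrightarrow> partial_deriv (slab a b m) k F v) X"
proof -
  \<comment> \<open>Convergence in the product topology is coordinatewise convergence.\<close>
  have "limitin (product_topology (\<lambda>_. euclidean) UNIV) p v X"
    unfolding limitin_componentwise limitin_canonical_iff using p by simp
  then have "(p \<longlongrightarrow> v) X"
    unfolding euclidean_product_topology limitin_canonical_iff .
  then show ?thesis
    by (rule continuous_on_tendsto_compose[OF conjunct2[OF bspec[OF F[unfolded C1_slab_def] k]] _ v assms(5)])
qed

text \<open>A Caratheodory form of differentiability, with coefficients that converge to the partial
  derivatives. It is phrased with filters and coordinates and needs no norm on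
  \<open>nat \<Rightarrow> real\<close>; continuity of F and the chain rule are both read off from
  it.\<close>

lemma slab_difference_expansion:
  assumes F: "C1_slab a b m F" and v: "v \<in> slab a b m"
    and p: "\<And>l. ((\<lambda>x. p x l) \<longlongrightarrow> v l) X" and ev: "\<forall>\<^sub>F x in X. p x \<in> slab a b m"
  shows "\<exists>q. (\<forall>k\<in>{1..m}. ((\<lambda>x. q x k) \<longlongrightarrow> partial_deriv (slab a b m) k F v) X) \<and>
    (\<forall>\<^sub>F x in X. F (p x) - F v = (\<Sum>k=1..m. (p x k - v k) * q x k))"
proof -
  have "\<forall>w\<in>slab a b m. \<exists>\<xi>.
    (\<forall>k. \<xi> k \<in> slab a b m \<and> (\<forall>l. \<xi> k l \<in> closed_segment (v l) (w l))) \<and>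
    F w - F v = (\<Sum>k=1..m. (w k - v k) * partial_deriv (slab a b m) k F (\<xi> k))"
    by (intro ballI slab_mean_value[OF F v])
  from bchoice[OF this] obtain \<xi> where "\<forall>w\<in>slab a b m.
    (\<forall>k. \<xi> w k \<in> slab a b m \<and> (\<forall>l. \<xi> w k l \<in> closed_segment (v l) (w l))) \<and>
    F w - F v = (\<Sum>k=1..m. (w k - v k) * partial_deriv (slab a b m) k F (\<xi> w k))"
    by (rule exE)
  note \<xi>0 = bspec[OF this]
  have \<xi>: "\<xi> w k \<in> slab a b m" "\<xi> w k l \<in> closed_segment (v l) (w l)"
    "F w - F v = (\<Sum>k=1..m. (w k - v k) * partial_deriv (slab a b m) k F (\<xi> w k))"
    if "w \<in> slab a b m" for w k l
    using \<xi>0[OF that, THEN conjunct1, THEN spec, of k] \<xi>0[OF that, THEN conjunct2] by simp_all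
  have "((\<lambda>x. partial_deriv (slab a b m) k F (\<xi> (p x) k)) \<longlongrightarrow> partial_deriv (slab a b m) k F v) X"
    if k: "k \<in> {1..m}" for k
  proof (rule tendsto_partial_deriv[OF F k v])
    fix l
    \<comment> \<open>The intermediate points lie coordinatewise between v and \<open>p x\<close>,
      hence converge to v.\<close>
    have "((\<lambda>x. norm (p x l - v l)) \<longlongrightarrow> 0) X"
      using p[of l] by (intro tendsto_norm_zero LIM_zero)
    moreover have "\<forall>\<^sub>F x in X. norm (\<xi> (p x) k l - v l) \<le> norm (p x l - v l)"
      using ev by (rule eventually_mono) (rule segment_bound1, rule \<xi>(2))
    ultimately have "((\<lambda>x. \<xi> (p x) k l - v l) \<longlongrightarrow> 0) X"
      by (rule Lim_null_comparison[rotated])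
    then show "((\<lambda>x. \<xi> (p x) k l) \<longlongrightarrow> v l) X"
      by (rule LIM_zero_cancel)
  next
    show "\<forall>\<^sub>F x in X. \<xi> (p x) k \<in> slab a b m"
      using ev by (rule eventually_mono) (rule \<xi>(1))
  qed
  moreover have "\<forall>\<^sub>F x in X. F (p x) - F v = (\<Sum>k=1..m. (p x k - v k) * partial_deriv (slab a b m) k F (\<xi> (p x) k))"
    using ev by (rule eventually_mono) (rule \<xi>(3))
  ultimately show ?thesis
    by (intro exI[of _ "\<lambda>x k. partial_deriv (slab a b m) k F (\<xi> (p x) k)"] conjI ballI)
qed

text \<open>\<open>C1_slab\<close> speaks only of partial derivatives, so joint continuity has to be
  derived: take the identity for p in the expansion.\<close>

lemma C1_slab_continuous_on:
  assumes F: "C1_slab a b m F"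
  shows "continuous_on (slab a b m) F"
  unfolding continuous_on_def
proof
  fix v assume v: "v \<in> slab a b m"
  let ?X = "at v within slab a b m"
  have p: "((\<lambda>w. w l) \<longlongrightarrow> v l) ?X" for l
    using continuous_on_subset[OF continuous_on_product_coordinates[of l], of "slab a b m"] v
    by (simp add: continuous_on_def)
  have ev: "\<forall>\<^sub>F w in ?X. w \<in> slab a b m"
    by (simp add: eventually_at_topological) blast
  obtain q where q: "\<And>k. k \<in> {1..m} \<Longrightarrow> ((\<lambda>x. q x k) \<longlongrightarrow> partial_deriv (slab a b m) k F v) ?X"
    "\<forall>\<^sub>F x in ?X. F x - F v = (\<Sum>k=1..m. (x k - v k) * q x k)"
    using slab_difference_expansion[OF F v p ev] by blast
  have "((\<lambda>x. \<Sum>k=1..m. (x k - v k) * q x k) \<longlongrightarrow> (\<Sum>k=1..m. (v k - v k) * partial_deriv (slab a b m) k F v)) ?X"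
    by (intro tendsto_intros p q)
  then have "((\<lambda>x. F x - F v) \<longlongrightarrow> 0) ?X"
    using q(2) by (simp add: filterlim_cong[OF refl refl q(2)])
  then show "(F \<longlongrightarrow> F v) ?X"
    by (rule LIM_zero_cancel)
qed

text \<open>Divide the expansion along p by y - x. The base set S is arbitrary because the rule is
  used both for a parameter ranging over all reals and for an end time within
  \<open>{a..b}\<close>.\<close>

lemma C1_slab_chain_rule:
  fixes p :: "real \<Rightarrow> nat \<Rightarrow> real"
  assumes F: "C1_slab a b m F"
    and p: "\<And>x. x \<in> S \<Longrightarrow> p x \<in> slab a b m" and x: "x \<in> S"
    and d: "\<And>l. ((\<lambda>x. p x l) has_vector_derivative p' l) (at x within S)"
  shows "((\<lambda>x. F (p x)) has_vector_derivative
     (\<Sum>k=1..m. p' k * partial_deriv (slab a b m) k F (p x))) (at x within S)"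
proof -
  let ?X = "at x within S"
  have lim: "((\<lambda>y. p y l) \<longlongrightarrow> p x l) ?X" for l
    using has_vector_derivative_continuous[OF d] by (simp add: continuous_within)
  have ev: "\<forall>\<^sub>F y in ?X. p y \<in> slab a b m"
    using eventually_at_topological[of "\<lambda>y. p y \<in> slab a b m" x S] p by blast
  obtain q where q: "\<And>k. k \<in> {1..m} \<Longrightarrow> ((\<lambda>y. q y k) \<longlongrightarrow> partial_deriv (slab a b m) k F (p x)) ?X"
    "\<forall>\<^sub>F y in ?X. F (p y) - F (p x) = (\<Sum>k=1..m. (p y k - p x k) * q y k)"
    using slab_difference_expansion[OF F p[OF x] lim ev] by blast
  have quot: "((\<lambda>y. (p y l - p x l) / (y - x)) \<longlongrightarrow> p' l) ?X" for l
    using d[of l] by (simp add: has_field_derivative_iff flip: has_real_derivative_iff_has_vector_derivative)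
  have "((\<lambda>y. \<Sum>k=1..m. ((p y k - p x k) / (y - x)) * q y k) \<longlongrightarrow>
      (\<Sum>k=1..m. p' k * partial_deriv (slab a b m) k F (p x))) ?X"
    by (intro tendsto_intros quot q)
  moreover have "\<forall>\<^sub>F y in ?X. (F (p y) - F (p x)) / (y - x) = (\<Sum>k=1..m. ((p y k - p x k) / (y - x)) * q y k)"
    using q(2) by eventually_elim (simp add: sum_divide_distrib)
  ultimately have "((\<lambda>y. (F (p y) - F (p x)) / (y - x)) \<longlongrightarrow>
      (\<Sum>k=1..m. p' k * partial_deriv (slab a b m) k F (p x))) ?X"
    by (simp add: filterlim_cong)
  then show ?thesis
    by (simp add: has_field_derivative_iff flip: has_real_derivative_iff_has_vector_derivative)
qed

subsection \<open>Fractional integrals of variable order\<close>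

text \<open>Integrals against a weakly singular kernel are uniform limits of integrals against continuous
  kernels; continuity in the parameter and the interchange of integrals pass to the limit.\<close>

lemma singular_kernel_limit:
  fixes \<kappa> w :: "real \<Rightarrow> real \<Rightarrow> real" and K :: "nat \<Rightarrow> real \<Rightarrow> real \<Rightarrow> real"
  assumes K: "\<And>m. continuous_on ({c..d} \<times> {c..d}) (\<lambda>(t, \<tau>). K m t \<tau>)"
    and r: "r \<longlonglongrightarrow> 0" "\<And>m. r m \<ge> 0"
    and bd: "\<And>m t \<tau>. t \<in> {c..d} \<Longrightarrow> \<tau> \<in> {c..d} \<Longrightarrow> \<bar>\<kappa> t \<tau> - K m t \<tau>\<bar> \<le> r m * w t \<tau>"
    and w: "\<And>t. t \<in> {c..d} \<Longrightarrow> w t integrable_on {c..d}"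
      "\<And>t. t \<in> {c..d} \<Longrightarrow> integral {c..d} (w t) \<le> B"
      "\<And>t \<tau>. w t \<tau> \<ge> 0"
    and g: "continuous_on {c..d} g"
  shows singular_kernel_integrable: "\<And>t. t \<in> {c..d} \<Longrightarrow> (\<lambda>\<tau>. \<kappa> t \<tau> * g \<tau>) integrable_on {c..d}" (is "PROP ?A")
    and singular_kernel_uniform_limit: "uniform_limit {c..d} (\<lambda>m t. integral {c..d} (\<lambda>\<tau>. K m t \<tau> * g \<tau>))
           (\<lambda>t. integral {c..d} (\<lambda>\<tau>. \<kappa> t \<tau> * g \<tau>)) sequentially"
    and singular_kernel_continuous: "continuous_on {c..d} (\<lambda>t. integral {c..d} (\<lambda>\<tau>. \<kappa> t \<tau> * g \<tau>))"
proof -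
  have "compact (g ` {c..d})"
    using g by (rule compact_continuous_image) simp
  then obtain G where "\<forall>y\<in>g ` {c..d}. norm y \<le> G"
    using compact_imp_bounded bounded_iff by blast
  then have G: "\<bar>g \<tau>\<bar> \<le> \<bar>G\<bar>" if "\<tau> \<in> {c..d}" for \<tau>
    using that by force
  obtain R where R: "\<And>m. \<bar>r m\<bar> \<le> R"
    using convergent_imp_Bseq[OF convergentI[OF r(1)]] unfolding Bseq_def by auto
  have cK: "continuous_on {c..d} (K m t)" if "t \<in> {c..d}" for m t
  proof -
    have "continuous_on {c..d} (\<lambda>\<tau>. (\<lambda>(t, \<tau>). K m t \<tau>) (t, \<tau>))"
      by (rule continuous_on_compose2[OF K]) (use that in \<open>auto intro!: continuous_intros\<close>)
    then show ?thesis by simp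
  qed
  have Kg: "(\<lambda>\<tau>. K m t \<tau> * g \<tau>) integrable_on {c..d}" if "t \<in> {c..d}" for m t
    by (intro integrable_continuous_real continuous_intros cK that g)
  show A: "PROP ?A"
  proof -
    fix t assume t: "t \<in> {c..d}"
    \<comment> \<open>By the triangle inequality through \<kappa>, every \<open>K m\<close> differs
      from \<open>K 0\<close> by at most \<open>2 * R * w\<close>; this gives a majorant independent
      of m.\<close>
    let ?h = "\<lambda>\<tau>. (\<bar>K 0 t \<tau>\<bar> + 2 * R * w t \<tau>) * \<bar>G\<bar>"
    show "(\<lambda>\<tau>. \<kappa> t \<tau> * g \<tau>) integrable_on {c..d}"
    proof (rule dominated_convergence(1)[of "\<lambda>m \<tau>. K m t \<tau> * g \<tau>" _ ?h])
      show "(\<lambda>\<tau>. K m t \<tau> * g \<tau>) integrable_on {c..d}" for m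
        using t by (rule Kg)
      have "(\<lambda>\<tau>. \<bar>K 0 t \<tau>\<bar>) integrable_on {c..d}"
        by (intro integrable_continuous_real continuous_intros cK t)
      moreover have "(\<lambda>\<tau>. 2 * R * w t \<tau>) integrable_on {c..d}"
        using w(1)[OF t] by (rule integrable_on_mult_right)
      ultimately have "(\<lambda>\<tau>. \<bar>K 0 t \<tau>\<bar> + 2 * R * w t \<tau>) integrable_on {c..d}"
        by (rule integrable_add)
      then show "?h integrable_on {c..d}"
        by (rule integrable_on_mult_left)
    next
      fix m \<tau> assume \<tau>: "\<tau> \<in> {c..d}"
      have "r m * w t \<tau> \<le> R * w t \<tau>" for m
        using R[of m] w(3)[of t \<tau>] by (intro mult_right_mono) auto
      then have "\<bar>\<kappa> t \<tau> - K m t \<tau>\<bar> \<le> R * w t \<tau>" for m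
        using bd[OF t \<tau>, of m] order_trans by blast
      from this[of m] this[of 0] have "\<bar>K m t \<tau>\<bar> \<le> \<bar>K 0 t \<tau>\<bar> + 2 * R * w t \<tau>"
        by linarith
      then show "norm (K m t \<tau> * g \<tau>) \<le> ?h \<tau>"
        using G[OF \<tau>] by (simp add: abs_mult mult_mono')
    next
      fix \<tau> assume \<tau>: "\<tau> \<in> {c..d}"
      have "(\<lambda>m. r m * w t \<tau>) \<longlonglongrightarrow> 0"
        using tendsto_mult_left_zero[OF r(1)] .
      then have "(\<lambda>m. K m t \<tau> - \<kappa> t \<tau>) \<longlonglongrightarrow> 0"
        by (rule Lim_null_comparison[rotated]) (use bd[OF t \<tau>] in \<open>simp add: abs_minus_commute\<close>)
      then show "(\<lambda>m. K m t \<tau> * g \<tau>) \<longlonglongrightarrow> \<kappa> t \<tau> * g \<tau>"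
        by (intro tendsto_mult tendsto_const) (rule LIM_zero_cancel)
    qed
  qed
  show ul: "uniform_limit {c..d} (\<lambda>m t. integral {c..d} (\<lambda>\<tau>. K m t \<tau> * g \<tau>))
           (\<lambda>t. integral {c..d} (\<lambda>\<tau>. \<kappa> t \<tau> * g \<tau>)) sequentially"
  proof (rule uniform_limitI)
    fix e :: real assume "e > 0"
    \<comment> \<open>The integrals of \<open>w t\<close> are bounded by B for all t at once, which
      makes the rate independent of t.\<close>
    have "(\<lambda>m. r m * (\<bar>G\<bar> * \<bar>B\<bar>)) \<longlonglongrightarrow> 0"
      using tendsto_mult_left_zero[OF r(1)] .
    then have "\<forall>\<^sub>F m in sequentially. r m * (\<bar>G\<bar> * \<bar>B\<bar>) < e"
      using \<open>e > 0\<close> by (rule order_tendstoD(2))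
    then show "\<forall>\<^sub>F m in sequentially. \<forall>t\<in>{c..d}.
      dist (integral {c..d} (\<lambda>\<tau>. K m t \<tau> * g \<tau>)) (integral {c..d} (\<lambda>\<tau>. \<kappa> t \<tau> * g \<tau>)) < e"
    proof (rule eventually_mono, intro ballI)
      fix m t assume m: "r m * (\<bar>G\<bar> * \<bar>B\<bar>) < e" and t: "t \<in> {c..d}"
      have "norm (integral {c..d} (\<lambda>\<tau>. K m t \<tau> * g \<tau> - \<kappa> t \<tau> * g \<tau>))
          \<le> integral {c..d} (\<lambda>\<tau>. r m * \<bar>G\<bar> * w t \<tau>)"
      proof (rule integral_norm_bound_integral)
        show "(\<lambda>\<tau>. K m t \<tau> * g \<tau> - \<kappa> t \<tau> * g \<tau>) integrable_on {c..d}"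
          by (intro integrable_diff Kg A t)
        show "(\<lambda>\<tau>. r m * \<bar>G\<bar> * w t \<tau>) integrable_on {c..d}"
          by (intro integrable_on_mult_right w t)
        fix \<tau> assume \<tau>: "\<tau> \<in> {c..d}"
        have "norm (K m t \<tau> * g \<tau> - \<kappa> t \<tau> * g \<tau>) = \<bar>\<kappa> t \<tau> - K m t \<tau>\<bar> * \<bar>g \<tau>\<bar>"
          by (simp add: abs_minus_commute left_diff_distrib flip: abs_mult)
        also have "\<dots> \<le> (r m * w t \<tau>) * \<bar>G\<bar>"
          using bd[OF t \<tau>] G[OF \<tau>] by (intro mult_mono') auto
        finally show "norm (K m t \<tau> * g \<tau> - \<kappa> t \<tau> * g \<tau>) \<le> r m * \<bar>G\<bar> * w t \<tau>"
          by (simp add: mult_ac)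
      qed
      also have "\<dots> = r m * \<bar>G\<bar> * integral {c..d} (w t)"
        by simp
      also have "\<dots> \<le> r m * \<bar>G\<bar> * \<bar>B\<bar>"
        using r(2)[of m] w(2)[OF t] by (intro mult_left_mono) auto
      also have "\<dots> < e" using m by (simp add: mult.assoc)
      finally show "dist (integral {c..d} (\<lambda>\<tau>. K m t \<tau> * g \<tau>)) (integral {c..d} (\<lambda>\<tau>. \<kappa> t \<tau> * g \<tau>)) < e"
        unfolding dist_norm integral_diff[OF Kg[OF t] A[OF t], symmetric] .
    qed
  qed
  show "continuous_on {c..d} (\<lambda>t. integral {c..d} (\<lambda>\<tau>. \<kappa> t \<tau> * g \<tau>))"
  proof (rule uniform_limit_theorem[OF _ ul])
    have "continuous_on {c..d} (\<lambda>t. integral (cbox c d) (\<lambda>\<tau>. K m t \<tau> * g \<tau>))" for m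
    proof (rule integral_continuous_on_param)
      show "continuous_on ({c..d} \<times> cbox c d) (\<lambda>(t, \<tau>). K m t \<tau> * g \<tau>)"
        using K[of m] unfolding case_prod_beta
        by (auto intro!: continuous_intros continuous_on_compose2[OF g])
    qed
    then show "\<forall>\<^sub>F m in sequentially. continuous_on {c..d} (\<lambda>t. integral {c..d} (\<lambda>\<tau>. K m t \<tau> * g \<tau>))"
      by simp
  qed simp
qed

text \<open>The two sides have different variables in the outer integral, so a uniform limit is
  needed in each of them. Fubini holds for each continuous \<open>K m\<close>, and both sides
  converge.\<close>

lemma singular_kernel_swap:
  fixes \<kappa> w w' :: "real \<Rightarrow> real \<Rightarrow> real" and K :: "nat \<Rightarrow> real \<Rightarrow> real \<Rightarrow> real"
  assumes K: "\<And>m. continuous_on ({c..d} \<times> {c..d}) (\<lambda>(t, \<tau>). K m t \<tau>)"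
    and f: "continuous_on {c..d} f" and g: "continuous_on {c..d} g"
    and 1: "uniform_limit {c..d} (\<lambda>m t. integral {c..d} (\<lambda>\<tau>. K m t \<tau> * g \<tau>))
           (\<lambda>t. integral {c..d} (\<lambda>\<tau>. \<kappa> t \<tau> * g \<tau>)) sequentially"
    and 2: "uniform_limit {c..d} (\<lambda>m \<tau>. integral {c..d} (\<lambda>t. K m t \<tau> * f t))
           (\<lambda>\<tau>. integral {c..d} (\<lambda>t. \<kappa> t \<tau> * f t)) sequentially"
  shows "integral {c..d} (\<lambda>t. f t * integral {c..d} (\<lambda>\<tau>. \<kappa> t \<tau> * g \<tau>)) =
         integral {c..d} (\<lambda>\<tau>. g \<tau> * integral {c..d} (\<lambda>t. \<kappa> t \<tau> * f t))"
proof -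
  have cKg: "continuous_on {c..d} (\<lambda>t. integral {c..d} (\<lambda>\<tau>. K m t \<tau> * g \<tau>))" for m
  proof -
    have "continuous_on ({c..d} \<times> cbox c d) (\<lambda>(t, \<tau>). K m t \<tau> * g \<tau>)"
      using K[of m] unfolding case_prod_beta
      by (auto intro!: continuous_intros continuous_on_compose2[OF g])
    from integral_continuous_on_param[OF this] show ?thesis by simp
  qed
  have K': "continuous_on ({c..d} \<times> {c..d}) (\<lambda>(\<tau>, t). K m t \<tau>)" for m
  proof -
    have "continuous_on ({c..d} \<times> {c..d}) (\<lambda>x. (\<lambda>(t, \<tau>). K m t \<tau>) (snd x, fst x))"
      by (rule continuous_on_compose2[OF K]) (auto intro!: continuous_intros)
    then show ?thesis by (simp add: case_prod_beta)
  qed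
  have cKf: "continuous_on {c..d} (\<lambda>\<tau>. integral {c..d} (\<lambda>t. K m t \<tau> * f t))" for m
  proof -
    have "continuous_on ({c..d} \<times> cbox c d) (\<lambda>(\<tau>, t). K m t \<tau> * f t)"
      using K'[of m] unfolding case_prod_beta
      by (auto intro!: continuous_intros continuous_on_compose2[OF f])
    from integral_continuous_on_param[OF this] show ?thesis by simp
  qed
  have lim: "(\<lambda>m. integral {c..d} (\<lambda>t. p t * F m t)) \<longlonglongrightarrow> integral {c..d} (\<lambda>t. p t * F' t)"
    if p: "continuous_on {c..d} p" and F: "\<And>m. continuous_on {c..d} (F m)"
      and ul: "uniform_limit {c..d} F F' sequentially" for p F' :: "real \<Rightarrow> real" and F
  proof -
    have F': "continuous_on {c..d} F'"
      using F by (intro uniform_limit_theorem[OF _ ul]) simp_all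
    have "uniform_limit {c..d} (\<lambda>m t. p t * F m t) (\<lambda>t. p t * F' t) sequentially"
      by (rule uniform_lim_mult[OF uniform_limit_const ul])
         (use p F' in \<open>auto intro: compact_imp_bounded compact_continuous_image\<close>)
    then obtain I J where IJ: "\<And>m. ((\<lambda>t. p t * F m t) has_integral I m) {c..d}"
       "((\<lambda>t. p t * F' t) has_integral J) {c..d}" "I \<longlonglongrightarrow> J"
      by (rule uniform_limit_integral) (auto intro!: continuous_intros p F)
    from IJ(3) show ?thesis
      unfolding integral_unique[OF IJ(1)] integral_unique[OF IJ(2)] .
  qed
  have swap: "integral {c..d} (\<lambda>t. f t * integral {c..d} (\<lambda>\<tau>. K m t \<tau> * g \<tau>)) =
        integral {c..d} (\<lambda>\<tau>. g \<tau> * integral {c..d} (\<lambda>t. K m t \<tau> * f t))" for m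
  proof -
    have "continuous_on (cbox (c, c) (d, d)) (\<lambda>(t, \<tau>). f t * (K m t \<tau> * g \<tau>))"
      using K[of m] unfolding case_prod_beta cbox_Pair_eq
      by (auto intro!: continuous_intros continuous_on_compose2[OF f] continuous_on_compose2[OF g])
    from integral_swap_continuous[OF this]
    have "integral {c..d} (\<lambda>t. integral {c..d} (\<lambda>\<tau>. f t * (K m t \<tau> * g \<tau>))) =
      integral {c..d} (\<lambda>\<tau>. integral {c..d} (\<lambda>t. f t * (K m t \<tau> * g \<tau>)))"
      by simp
    also have "(\<lambda>\<tau>. integral {c..d} (\<lambda>t. f t * (K m t \<tau> * g \<tau>))) =
       (\<lambda>\<tau>. integral {c..d} (\<lambda>t. g \<tau> * (K m t \<tau> * f t)))"
      by (simp add: mult_ac)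
    finally show ?thesis by (simp only: integral_mult_right)
  qed
  show ?thesis
    using lim[OF f cKg 1] lim[OF g cKf 2] unfolding swap by (rule LIMSEQ_unique)
qed

section \<open>Truncation of the weakly singular kernel\<close>

lemma has_integral_powr_left:
  fixes c t s :: real
  assumes "c \<le> t" "0 < s"
  shows "((\<lambda>\<tau>. (t - \<tau>) powr (s - 1)) has_integral (t - c) powr s / s) {c..t}"
proof -
  have "((\<lambda>\<tau>. (t - \<tau>) powr (s - 1)) has_integral - ((t - t) powr s / s) - - ((t - c) powr s / s)) {c..t}"
  \<comment> \<open>The integrand may be unbounded near t; there only the continuity of the
    antiderivative is needed.\<close>
  proof (rule fundamental_theorem_of_calculus_interior[OF assms(1)])
    show "continuous_on {c..t} (\<lambda>\<tau>. - ((t - \<tau>) powr s / s))"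
      using assms by (auto intro!: continuous_intros continuous_on_powr')
    fix \<tau> assume "\<tau> \<in> {c<..<t}"
    then show "((\<lambda>\<tau>. - ((t - \<tau>) powr s / s)) has_vector_derivative (t - \<tau>) powr (s - 1)) (at \<tau>)"
      using assms unfolding has_real_derivative_iff_has_vector_derivative[symmetric]
      by (auto intro!: derivative_eq_intros)
  qed
  then show ?thesis using assms by simp
qed

lemma has_integral_powr_right:
  fixes d t s :: real
  assumes "t \<le> d" "0 < s"
  shows "((\<lambda>\<tau>. (\<tau> - t) powr (s - 1)) has_integral (d - t) powr s / s) {t..d}"
proof -
  have "((\<lambda>\<tau>. (\<tau> - t) powr (s - 1)) has_integral ((d - t) powr s / s) - ((t - t) powr s / s)) {t..d}"
  proof (rule fundamental_theorem_of_calculus_interior[OF assms(1)])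
    show "continuous_on {t..d} (\<lambda>\<tau>. ((\<tau> - t) powr s / s))"
      using assms by (auto intro!: continuous_intros continuous_on_powr')
    fix \<tau> assume "\<tau> \<in> {t<..<d}"
    then show "((\<lambda>\<tau>. ((\<tau> - t) powr s / s)) has_vector_derivative (\<tau> - t) powr (s - 1)) (at \<tau>)"
      using assms unfolding has_real_derivative_iff_has_vector_derivative[symmetric]
      by (auto intro!: derivative_eq_intros)
  qed
  then show ?thesis using assms by simp
qed

text \<open>Continuous across the diagonal, and equal to the kernel where \<open>u - v \<ge> \<epsilon>\<close>.\<close>

definition trunc_kernel :: "nat \<Rightarrow> (real \<Rightarrow> real \<Rightarrow> real) \<Rightarrow> real \<Rightarrow> real \<Rightarrow> real \<Rightarrow> real" where
  "trunc_kernel i \<delta> \<epsilon> u v =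
     max (u - v) \<epsilon> powr (real i - 2 - \<delta> u v) * max 0 (u - v) * rGamma (real i - \<delta> u v)"

text \<open>The reciprocal Gamma function is entire, so continuity and bounds in the order need no
  care about poles.\<close>

lemma frac_kernel_rGamma:
  "frac_kernel i \<delta> u v = (u - v) powr (real i - 1 - \<delta> u v) * rGamma (real i - \<delta> u v)"
  by (simp add: frac_kernel_def rGamma_inverse_Gamma divide_inverse)

text \<open>The error lives on 0 < u - v < \<epsilon>, where it is at most the kernel itself. The
  exponent of the kernel is at least 2s - 1: one s is spent on the rate
  \<open>\<epsilon> powr s\<close>, and the other keeps the majorant
  \<open>(u - v) powr (s - 1)\<close> integrable.\<close>

lemma trunc_kernel_error:
  assumes s: "s > 0" "2 * s \<le> real i - \<delta> u v" "real i - \<delta> u v < 1" and "v \<le> u"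
    and e: "0 < \<epsilon>" "\<epsilon> \<le> 1" and C: "rGamma (real i - \<delta> u v) \<le> C"
  shows "\<bar>frac_kernel i \<delta> u v - trunc_kernel i \<delta> \<epsilon> u v\<bar> \<le> C * \<epsilon> powr s * (u - v) powr (s - 1)"
proof (cases "u = v")
  case True
  then show ?thesis by (simp add: frac_kernel_def trunc_kernel_def)
next
  case False
  define h where "h = u - v"
  define p where "p = real i - \<delta> u v"
  define G where "G = rGamma p"
  have h: "h > 0" using False \<open>v \<le> u\<close> by (simp add: h_def)
  have p: "2 * s \<le> p" "p < 1" using s by (simp_all add: p_def)
  have G: "0 \<le> G" "G \<le> C"
    using C s by (simp_all add: G_def p_def rGamma_inverse_Gamma Gamma_real_pos less_imp_le)
  have k: "frac_kernel i \<delta> u v = h powr (p - 1) * G"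
    by (simp add: frac_kernel_rGamma h_def p_def G_def algebra_simps)
  have tr: "trunc_kernel i \<delta> \<epsilon> u v = max h \<epsilon> powr (p - 2) * h * G"
    using h by (simp add: trunc_kernel_def h_def[symmetric] p_def G_def algebra_simps)
  have hp: "h powr (p - 2) * h = h powr (p - 1)"
    using h powr_mult_base[of h "p - 2"] by (simp add: mult.commute)
  show ?thesis
  proof (cases "\<epsilon> \<le> h")
    case True
    then have "frac_kernel i \<delta> u v - trunc_kernel i \<delta> \<epsilon> u v = 0"
      using hp by (simp add: k tr max_def)
    then show ?thesis using G by simp
  next
    case False
    then have mx: "max h \<epsilon> = \<epsilon>" by simp
    \<comment> \<open>The exponent p - 2 is negative, so truncation lowers the kernel and the
      truncated kernel lies between 0 and the original one.\<close>
    have "\<epsilon> powr (p - 2) \<le> h powr (p - 2)"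
      using False h p by (intro powr_mono2') auto
    then have "\<epsilon> powr (p - 2) * h * G \<le> h powr (p - 1) * G"
      unfolding hp[symmetric] using h G by (intro mult_right_mono) auto
    moreover have "0 \<le> \<epsilon> powr (p - 2) * h * G" using h G by simp
    ultimately have "\<bar>frac_kernel i \<delta> u v - trunc_kernel i \<delta> \<epsilon> u v\<bar> \<le> h powr (p - 1) * G"
      by (simp add: k tr mx)
    also have "\<dots> \<le> (\<epsilon> powr s * h powr (s - 1)) * C"
    proof (rule mult_mono[OF _ G(2) _ G(1)])
      have "h powr (p - 1) \<le> h powr (2 * s - 1)"
        using False h p e by (intro powr_mono') auto
      also have "\<dots> = h powr s * h powr (s - 1)"
        using h by (simp flip: powr_add)
      also have "\<dots> \<le> \<epsilon> powr s * h powr (s - 1)"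
        using False h s by (intro mult_right_mono powr_mono2) auto
      finally show "h powr (p - 1) \<le> \<epsilon> powr s * h powr (s - 1)" .
    qed simp
    finally show ?thesis by (simp add: h_def mult_ac)
  qed
qed

text \<open>The interval is a parameter because the facts are needed on \<open>{a..b}\<close>,
  \<open>{a..T}\<close> and \<open>{T..b}\<close>.\<close>

locale variable_order =
  fixes c d :: real and i :: nat and \<delta> :: "real \<Rightarrow> real \<Rightarrow> real"
  assumes le: "c \<le> d"
    and order_continuous: "continuous_on ({c..d} \<times> {c..d}) (\<lambda>(t, \<tau>). \<delta> t \<tau>)"
    and order_range: "\<And>t \<tau>. t \<in> {c..d} \<Longrightarrow> \<tau> \<in> {c..d} \<Longrightarrow> \<delta> t \<tau> \<in> {real i - 1<..<real i}"
begin

lemma continuous_trunc_kernel: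
  assumes "0 < \<epsilon>"
  shows "continuous_on ({c..d} \<times> {c..d}) (\<lambda>(u, v). trunc_kernel i \<delta> \<epsilon> u v)"
proof -
  have [continuous_intros]: "continuous_on ({c..d} \<times> {c..d}) (\<lambda>x. \<delta> (fst x) (snd x))"
    using order_continuous by (simp add: case_prod_beta)
  show ?thesis
    unfolding trunc_kernel_def case_prod_beta using assms
    by (intro continuous_intros continuous_on_compose2[OF continuous_on_rGamma[of UNIV]]) (auto simp: max_def)
qed

text \<open>On the compact square the continuous function i - \<delta> attains a positive minimum; s
  is half of it, as \<open>trunc_kernel_error\<close> requires.\<close>

lemma order_bounds:
  obtains s C where "s > 0" "\<And>t \<tau>. t \<in> {c..d} \<Longrightarrow> \<tau> \<in> {c..d} \<Longrightarrow> 2 * s \<le> real i - \<delta> t \<tau>"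
    "\<And>t \<tau>. t \<in> {c..d} \<Longrightarrow> \<tau> \<in> {c..d} \<Longrightarrow> rGamma (real i - \<delta> t \<tau>) \<le> C"
proof -
  let ?Q = "{c..d} \<times> {c..d}"
  have Q: "compact ?Q" "?Q \<noteq> {}" using le by (auto intro: compact_Times)
  have cd: "continuous_on ?Q (\<lambda>x. \<delta> (fst x) (snd x))"
    using order_continuous by (simp add: case_prod_beta)
  have "continuous_on ?Q (\<lambda>x. real i - \<delta> (fst x) (snd x))"
    by (intro continuous_intros cd)
  from continuous_attains_inf[OF Q this]
  obtain x where x: "x \<in> ?Q" "\<And>y. y \<in> ?Q \<Longrightarrow> real i - \<delta> (fst x) (snd x) \<le> real i - \<delta> (fst y) (snd y)"
    by blast
  have "continuous_on ?Q (\<lambda>x. rGamma (real i - \<delta> (fst x) (snd x)))"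
    by (intro continuous_on_compose2[OF continuous_on_rGamma[of UNIV]] continuous_intros cd) simp
  from continuous_attains_sup[OF Q this]
  obtain z where z: "\<And>y. y \<in> ?Q \<Longrightarrow> rGamma (real i - \<delta> (fst y) (snd y)) \<le> rGamma (real i - \<delta> (fst z) (snd z))"
    by blast
  show ?thesis
  proof (rule that)
    show "(real i - \<delta> (fst x) (snd x)) / 2 > 0"
      using x(1) order_range[of "fst x" "snd x"] by (auto simp: mem_Times_iff)
    show "2 * ((real i - \<delta> (fst x) (snd x)) / 2) \<le> real i - \<delta> t \<tau>" if "t \<in> {c..d}" "\<tau> \<in> {c..d}" for t \<tau>
      using x(2)[of "(t, \<tau>)"] that by simp
    show "rGamma (real i - \<delta> t \<tau>) \<le> rGamma (real i - \<delta> (fst z) (snd z))" if "t \<in> {c..d}" "\<tau> \<in> {c..d}" for t \<tau>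
      using z[of "(t, \<tau>)"] that by simp
  qed
qed

text \<open>Extending the kernel by 0 to v > u turns the left and the right fractional integral into
  integrals of one function \<kappa> over the fixed interval, in its second and its first
  variable.\<close>

lemma kernel_facts:
  assumes f: "continuous_on {c..d} f" and g: "continuous_on {c..d} g"
  defines "\<kappa> \<equiv> \<lambda>u v. if v \<le> u then frac_kernel i \<delta> u v else 0"
  shows kernel_integrable1: "\<And>t. t \<in> {c..d} \<Longrightarrow> (\<lambda>\<tau>. \<kappa> t \<tau> * g \<tau>) integrable_on {c..d}"
    and kernel_continuous1: "continuous_on {c..d} (\<lambda>t. integral {c..d} (\<lambda>\<tau>. \<kappa> t \<tau> * g \<tau>))"
    and kernel_integrable2: "\<And>\<tau>. \<tau> \<in> {c..d} \<Longrightarrow> (\<lambda>t. \<kappa> t \<tau> * f t) integrable_on {c..d}"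
    and kernel_continuous2: "continuous_on {c..d} (\<lambda>\<tau>. integral {c..d} (\<lambda>t. \<kappa> t \<tau> * f t))"
    and kernel_swap: "integral {c..d} (\<lambda>t. f t * integral {c..d} (\<lambda>\<tau>. \<kappa> t \<tau> * g \<tau>)) =
         integral {c..d} (\<lambda>\<tau>. g \<tau> * integral {c..d} (\<lambda>t. \<kappa> t \<tau> * f t))"
proof -
  obtain s C where s: "s > 0" "\<And>t \<tau>. t \<in> {c..d} \<Longrightarrow> \<tau> \<in> {c..d} \<Longrightarrow> 2 * s \<le> real i - \<delta> t \<tau>"
    "\<And>t \<tau>. t \<in> {c..d} \<Longrightarrow> \<tau> \<in> {c..d} \<Longrightarrow> rGamma (real i - \<delta> t \<tau>) \<le> C"
    by (rule order_bounds) blast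
  have "C \<ge> rGamma (real i - \<delta> c c)" "0 \<le> rGamma (real i - \<delta> c c)"
    using s(3)[of c c] le order_range[of c c]
    by (auto simp: rGamma_inverse_Gamma Gamma_real_pos less_imp_le)
  then have C: "C \<ge> 0" by linarith
  \<comment> \<open>Truncation at level 1/(m+1): r is the rate and w the majorant of
    \<open>trunc_kernel_error\<close>, and B bounds the integrals of w in either variable.\<close>
  define r where "r = (\<lambda>m. C * (inverse (real (Suc m))) powr s)"
  define K where "K = (\<lambda>m. trunc_kernel i \<delta> (inverse (real (Suc m))))"
  define w where "w = (\<lambda>u v. if v \<le> u then (u - v) powr (s - 1) else 0)"
  define B where "B = (d - c) powr s / s"
  have K: "continuous_on ({c..d} \<times> {c..d}) (\<lambda>(t, \<tau>). K m t \<tau>)" for m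
    unfolding K_def by (rule continuous_trunc_kernel) simp
  have K': "continuous_on ({c..d} \<times> {c..d}) (\<lambda>(\<tau>, t). K m t \<tau>)" for m
  proof -
    have "continuous_on ({c..d} \<times> {c..d}) (\<lambda>x. (\<lambda>(t, \<tau>). K m t \<tau>) (snd x, fst x))"
      by (rule continuous_on_compose2[OF K]) (auto intro!: continuous_intros)
    then show ?thesis by (simp add: case_prod_beta)
  qed
  have "(\<lambda>m. C * (inverse (real (Suc m))) powr s) \<longlonglongrightarrow> C * 0 powr s"
    by (intro tendsto_mult_left tendsto_powr' LIMSEQ_inverse_real_of_nat tendsto_const) (use s in auto)
  then have r: "r \<longlonglongrightarrow> 0" "\<And>m. r m \<ge> 0"
    using C by (simp_all add: r_def)
  have bd: "\<bar>\<kappa> u v - K m u v\<bar> \<le> r m * w u v" if "u \<in> {c..d}" "v \<in> {c..d}" for m u v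
  proof (cases "v \<le> u")
    case True
    have "\<bar>frac_kernel i \<delta> u v - trunc_kernel i \<delta> (inverse (real (Suc m))) u v\<bar>
      \<le> C * inverse (real (Suc m)) powr s * (u - v) powr (s - 1)"
      by (rule trunc_kernel_error)
         (use True s that order_range[of u v] in \<open>auto simp: field_simps\<close>)
    then show ?thesis using True by (simp add: \<kappa>_def K_def r_def w_def)
  next
    case False
    then show ?thesis by (simp add: \<kappa>_def K_def w_def trunc_kernel_def)
  qed
  have w1: "(w t has_integral (t - c) powr s / s) {c..d}" if "t \<in> {c..d}" for t
  proof -
    have "((\<lambda>\<tau>. if \<tau> \<in> {c..t} then (t - \<tau>) powr (s - 1) else 0) has_integral (t - c) powr s / s) {c..d}"
      using has_integral_powr_left[of c t s] s that by (subst has_integral_restrict) auto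
    then show ?thesis
      by (rule has_integral_eq[rotated]) (auto simp: w_def)
  qed
  have w2: "((\<lambda>t. w t \<tau>) has_integral (d - \<tau>) powr s / s) {c..d}" if "\<tau> \<in> {c..d}" for \<tau>
  proof -
    have "((\<lambda>t. if t \<in> {\<tau>..d} then (t - \<tau>) powr (s - 1) else 0) has_integral (d - \<tau>) powr s / s) {c..d}"
      using has_integral_powr_right[of \<tau> d s] s that by (subst has_integral_restrict) auto
    then show ?thesis
      by (rule has_integral_eq[rotated]) (auto simp: w_def)
  qed
  have B1: "(t - c) powr s / s \<le> B" "(d - t) powr s / s \<le> B" if "t \<in> {c..d}" for t
    using that s unfolding B_def by (auto intro!: divide_right_mono powr_mono2)
  have w0: "w u v \<ge> 0" for u v by (simp add: w_def)
  have w1': "\<And>t. t \<in> {c..d} \<Longrightarrow> w t integrable_on {c..d}"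
      "\<And>t. t \<in> {c..d} \<Longrightarrow> integral {c..d} (w t) \<le> B"
    using w1 B1 by (auto simp: integral_unique[OF w1] integrable_on_def)
  have w2': "\<And>t. t \<in> {c..d} \<Longrightarrow> (\<lambda>u. w u t) integrable_on {c..d}"
      "\<And>t. t \<in> {c..d} \<Longrightarrow> integral {c..d} (\<lambda>u. w u t) \<le> B"
    using w2 B1 by (auto simp: integral_unique[OF w2] integrable_on_def)
  have bd': "\<bar>\<kappa> v u - K m v u\<bar> \<le> r m * w v u" if "u \<in> {c..d}" "v \<in> {c..d}" for m u v
    using that by (intro bd)
  note 1 = singular_kernel_limit[of c d K r \<kappa> w B g, OF K r bd w1' w0 g]
  \<comment> \<open>The transposed kernel gives the facts for integration in the first
    variable.\<close>
  note 2 = singular_kernel_limit[of c d "\<lambda>m \<tau> t. K m t \<tau>" r "\<lambda>\<tau> t. \<kappa> t \<tau>" "\<lambda>\<tau> t. w t \<tau>" B f, OF K' r bd' w2' w0 f]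
  show "(\<lambda>\<tau>. \<kappa> t \<tau> * g \<tau>) integrable_on {c..d}" if "t \<in> {c..d}" for t
    by (rule 1(1)) (assumption | rule that)+
  show "continuous_on {c..d} (\<lambda>t. integral {c..d} (\<lambda>\<tau>. \<kappa> t \<tau> * g \<tau>))"
    by (rule 1(3))
  show "(\<lambda>t. \<kappa> t \<tau> * f t) integrable_on {c..d}" if "\<tau> \<in> {c..d}" for \<tau>
    by (rule 2(1)) (assumption | rule that)+
  show "continuous_on {c..d} (\<lambda>\<tau>. integral {c..d} (\<lambda>t. \<kappa> t \<tau> * f t))"
    by (rule 2(3))
  show "integral {c..d} (\<lambda>t. f t * integral {c..d} (\<lambda>\<tau>. \<kappa> t \<tau> * g \<tau>)) =
         integral {c..d} (\<lambda>\<tau>. g \<tau> * integral {c..d} (\<lambda>t. \<kappa> t \<tau> * f t))"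
    by (rule singular_kernel_swap[OF K f g]; rule 1(2) 2(2))
qed

section \<open>Left and right fractional integrals as integrals over the whole interval\<close>

lemma left_kernel_eq:
  assumes "t \<in> {c..d}" "\<tau> \<in> {c..d}"
  shows "(if \<tau> \<le> t then frac_kernel i \<delta> t \<tau> else 0) * g \<tau> =
    (if \<tau> \<in> {c..t} then frac_kernel i \<delta> t \<tau> * g \<tau> else 0)"
  using assms by auto

lemma right_kernel_eq:
  assumes "t \<in> {c..d}" "\<tau> \<in> {c..d}"
  shows "(if t \<le> \<tau> then frac_kernel i \<delta> \<tau> t else 0) * g \<tau> =
    (if \<tau> \<in> {t..d} then frac_kernel i \<delta> \<tau> t * g \<tau> else 0)"
  using assms by auto

lemma left_int_eq:
  assumes t: "t \<in> {c..d}"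
  shows "left_int i \<delta> c g t =
    integral {c..d} (\<lambda>\<tau>. (if \<tau> \<le> t then frac_kernel i \<delta> t \<tau> else 0) * g \<tau>)"
proof -
  have "integral {c..d} (\<lambda>\<tau>. (if \<tau> \<le> t then frac_kernel i \<delta> t \<tau> else 0) * g \<tau>) =
     integral {c..d} (\<lambda>\<tau>. if \<tau> \<in> {c..t} then frac_kernel i \<delta> t \<tau> * g \<tau> else 0)"
    by (intro integral_cong left_kernel_eq[OF t])
  also have "\<dots> = integral ({c..t} \<inter> {c..d}) (\<lambda>\<tau>. frac_kernel i \<delta> t \<tau> * g \<tau>)"
    by (rule integral_restrict_Int)
  also have "{c..t} \<inter> {c..d} = {c..t}" using t by auto
  finally show ?thesis by (simp add: left_int_def)
qed

lemma right_int_eq: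
  assumes t: "t \<in> {c..d}"
  shows "right_int i \<delta> d g t =
    integral {c..d} (\<lambda>\<tau>. (if t \<le> \<tau> then frac_kernel i \<delta> \<tau> t else 0) * g \<tau>)"
proof -
  have "integral {c..d} (\<lambda>\<tau>. (if t \<le> \<tau> then frac_kernel i \<delta> \<tau> t else 0) * g \<tau>) =
     integral {c..d} (\<lambda>\<tau>. if \<tau> \<in> {t..d} then frac_kernel i \<delta> \<tau> t * g \<tau> else 0)"
    by (intro integral_cong right_kernel_eq[OF t])
  also have "\<dots> = integral ({t..d} \<inter> {c..d}) (\<lambda>\<tau>. frac_kernel i \<delta> \<tau> t * g \<tau>)"
    by (rule integral_restrict_Int)
  also have "{t..d} \<inter> {c..d} = {t..d}" using t by auto
  finally show ?thesis by (simp add: right_int_def)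
qed

lemma left_integrable:
  assumes g: "continuous_on {c..d} g" and t: "t \<in> {c..d}"
  shows "(\<lambda>\<tau>. frac_kernel i \<delta> t \<tau> * g \<tau>) integrable_on {c..t}"
proof -
  have "(\<lambda>\<tau>. if \<tau> \<in> {c..t} then frac_kernel i \<delta> t \<tau> * g \<tau> else 0) integrable_on {c..d}"
    using kernel_integrable1[OF g g t] by (rule integrable_eq) (rule left_kernel_eq[OF t])
  then show ?thesis
    using t by (subst (asm) integrable_restrict_Int) (auto simp: Int_absorb2)
qed

lemma right_integrable:
  assumes g: "continuous_on {c..d} g" and t: "t \<in> {c..d}"
  shows "(\<lambda>\<tau>. frac_kernel i \<delta> \<tau> t * g \<tau>) integrable_on {t..d}"
proof -
  have "(\<lambda>\<tau>. if \<tau> \<in> {t..d} then frac_kernel i \<delta> \<tau> t * g \<tau> else 0) integrable_on {c..d}"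
    using kernel_integrable2[OF g g t] by (rule integrable_eq) (rule right_kernel_eq[OF t])
  then show ?thesis
    using t by (subst (asm) integrable_restrict_Int) (auto simp: Int_absorb2)
qed

lemma continuous_left_int:
  assumes "continuous_on {c..d} g"
  shows "continuous_on {c..d} (left_int i \<delta> c g)"
  using kernel_continuous1[OF assms assms] by (rule continuous_on_eq) (simp add: left_int_eq)

lemma continuous_right_int:
  assumes "continuous_on {c..d} g"
  shows "continuous_on {c..d} (right_int i \<delta> d g)"
  using kernel_continuous2[OF assms assms] by (rule continuous_on_eq) (simp add: right_int_eq)

text \<open>The two operators are adjoint because they integrate the same \<kappa>, one in its
  second and the other in its first variable.\<close>

lemma fractional_integration_by_parts:
  assumes f: "continuous_on {c..d} f" and g: "continuous_on {c..d} g"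
  shows "integral {c..d} (\<lambda>t. f t * left_int i \<delta> c g t) = integral {c..d} (\<lambda>t. g t * right_int i \<delta> d f t)"
proof -
  have "integral {c..d} (\<lambda>t. f t * left_int i \<delta> c g t) =
    integral {c..d} (\<lambda>t. f t * integral {c..d} (\<lambda>\<tau>. (if \<tau> \<le> t then frac_kernel i \<delta> t \<tau> else 0) * g \<tau>))"
    by (intro integral_cong) (simp add: left_int_eq)
  also have "\<dots> = integral {c..d} (\<lambda>\<tau>. g \<tau> * integral {c..d} (\<lambda>t. (if \<tau> \<le> t then frac_kernel i \<delta> t \<tau> else 0) * f t))"
    by (rule kernel_swap[OF f g])
  also have "\<dots> = integral {c..d} (\<lambda>t. g t * right_int i \<delta> d f t)"
    by (intro integral_cong) (simp add: right_int_eq)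
  finally show ?thesis .
qed

text \<open>h is compared with the combination only on the interval, since the derivatives of
  admissible functions are known only there.\<close>

lemma left_int_linear:
  assumes f: "continuous_on {c..d} f" and g: "continuous_on {c..d} g" and t: "t \<in> {c..d}"
    and h: "\<And>\<tau>. \<tau> \<in> {c..d} \<Longrightarrow> h \<tau> = f \<tau> + p * g \<tau>"
  shows "left_int i \<delta> c h t = left_int i \<delta> c f t + p * left_int i \<delta> c g t"
proof -
  have "left_int i \<delta> c h t = integral {c..t} (\<lambda>\<tau>. frac_kernel i \<delta> t \<tau> * f \<tau> + p * (frac_kernel i \<delta> t \<tau> * g \<tau>))"
    unfolding left_int_def using h t by (intro integral_cong) (auto simp: algebra_simps)
  also have "\<dots> = left_int i \<delta> c f t + p * left_int i \<delta> c g t"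
    unfolding left_int_def
    by (subst integral_add) (auto intro!: integrable_on_mult_right left_integrable f g t)
  finally show ?thesis .
qed

lemma right_int_linear:
  assumes f: "continuous_on {c..d} f" and g: "continuous_on {c..d} g" and t: "t \<in> {c..d}"
    and h: "\<And>\<tau>. \<tau> \<in> {c..d} \<Longrightarrow> h \<tau> = f \<tau> + p * g \<tau>"
  shows "right_int i \<delta> d h t = right_int i \<delta> d f t + p * right_int i \<delta> d g t"
proof -
  have "right_int i \<delta> d h t = integral {t..d} (\<lambda>\<tau>. frac_kernel i \<delta> \<tau> t * f \<tau> + p * (frac_kernel i \<delta> \<tau> t * g \<tau>))"
    unfolding right_int_def using h t by (intro integral_cong) (auto simp: algebra_simps)
  also have "\<dots> = right_int i \<delta> d f t + p * right_int i \<delta> d g t"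
    unfolding right_int_def
    by (subst integral_add) (auto intro!: integrable_on_mult_right right_integrable f g t)
  finally show ?thesis .
qed

end

subsection \<open>First variation and optimality conditions\<close>

text \<open>Leibniz rule under the integral. The direction w leaves the first argument, time,
  unchanged, so the varied points stay in the slab for every real e.\<close>

lemma first_variation_integral:
  fixes v w :: "real \<Rightarrow> nat \<Rightarrow> real"
  assumes F: "C1_slab a b m F"
    and v: "\<And>t. t \<in> {a..T} \<Longrightarrow> v t \<in> slab a b m"
    and w: "\<And>t k. k \<notin> {2..m} \<Longrightarrow> w t k = 0"
    and cv: "\<And>k. continuous_on {a..T} (\<lambda>t. v t k)"
    and cw: "\<And>k. continuous_on {a..T} (\<lambda>t. w t k)"
  shows "((\<lambda>e. integral {a..T} (\<lambda>t. F (\<lambda>k. v t k + e * w t k))) has_vector_derivative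
      integral {a..T} (\<lambda>t. \<Sum>k=1..m. w t k * partial_deriv (slab a b m) k F (v t))) (at 0)"
proof -
  define p where "p = (\<lambda>e t k. v t k + e * w t k)"
  have p: "p e t \<in> slab a b m" if "t \<in> {a..T}" for e t
  proof -
    have "v t 1 \<in> {a..b}" "\<And>l. l \<notin> {1..m} \<Longrightarrow> v t l = 0"
      using v[OF that] unfolding slab_def mem_Collect_eq by blast+
    then have "p e t 1 \<in> {a..b}" "\<And>l. l \<notin> {1..m} \<Longrightarrow> p e t l = 0"
      using w by (simp_all add: p_def)
    then show ?thesis unfolding slab_def mem_Collect_eq by blast
  qed
  have cp: "continuous_on (UNIV \<times> {a..T}) (\<lambda>x. p (fst x) (snd x))"
    unfolding p_def
    by (intro continuous_on_coordinatewise_then_product continuous_intros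
        continuous_on_compose2[OF cv] continuous_on_compose2[OF cw]) auto
  have cD: "continuous_on (UNIV \<times> {a..T}) (\<lambda>x. partial_deriv (slab a b m) k F (p (fst x) (snd x)))"
    if "k \<in> {1..m}" for k
    by (rule continuous_on_compose2[OF conjunct2[OF bspec[OF F[unfolded C1_slab_def] that]] cp])
       (use p in auto)
  let ?D = "\<lambda>e t. \<Sum>k=1..m. w t k * partial_deriv (slab a b m) k F (p e t)"
  have "((\<lambda>e. integral (cbox a T) (\<lambda>t. F (p e t))) has_vector_derivative integral (cbox a T) (?D 0)) (at 0 within UNIV)"
  proof (rule leibniz_rule_vector_derivative)
    fix e t assume "t \<in> cbox a T"
    then have t: "t \<in> {a..T}" by simp
    show "((\<lambda>e. F (p e t)) has_vector_derivative ?D e t) (at e within UNIV)"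
    proof (rule C1_slab_chain_rule[OF F])
      show "((\<lambda>e. p e t l) has_vector_derivative w t l) (at e within UNIV)" for l
        unfolding p_def by (auto intro!: derivative_eq_intros)
    qed (use p t in auto)
  next
    fix e
    have "continuous_on {a..T} (\<lambda>t. p (fst (e, t)) (snd (e, t)))"
      by (rule continuous_on_compose2[OF cp]) (auto intro!: continuous_on_Pair)
    then have "continuous_on {a..T} (\<lambda>t. p e t)" by simp
    then have "continuous_on {a..T} (\<lambda>t. F (p e t))"
      by (rule continuous_on_compose2[OF C1_slab_continuous_on[OF F]]) (use p in blast)
    then show "(\<lambda>t. F (p e t)) integrable_on cbox a T"
      by (simp add: integrable_continuous_real)
  next
    show "continuous_on (UNIV \<times> cbox a T) (\<lambda>(e, t). ?D e t)"
      unfolding case_prod_beta cbox_interval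
      by (intro continuous_intros continuous_on_compose2[OF cw] cD) auto
  qed auto
  then show ?thesis by (simp add: p_def)
qed

locale variational_problem =
  fixes a b T xa :: real and n :: nat
    and \<alpha> \<beta> :: "nat \<Rightarrow> real \<Rightarrow> real \<Rightarrow> real"
    and \<gamma> :: "nat \<Rightarrow> real \<times> real"
    and L :: "(nat \<Rightarrow> real) \<Rightarrow> real"
    and \<phi> :: "real \<Rightarrow> real \<Rightarrow> real"
    and xa' :: "nat \<Rightarrow> real"
    and x :: "real \<Rightarrow> real"
  assumes ab: "a < b" and n: "n \<ge> 1"
    and \<alpha>_continuous: "\<And>i. i \<in> {1..n} \<Longrightarrow> continuous_on ({a..b} \<times> {a..b}) (\<lambda>(t, \<tau>). \<alpha> i t \<tau>)"
    and \<alpha>_range: "\<And>i t \<tau>. i \<in> {1..n} \<Longrightarrow> t \<in> {a..b} \<Longrightarrow> \<tau> \<in> {a..b} \<Longrightarrow> \<alpha> i t \<tau> \<in> {real i - 1<..<real i}"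
    and \<beta>_continuous: "\<And>i. i \<in> {1..n} \<Longrightarrow> continuous_on ({a..b} \<times> {a..b}) (\<lambda>(t, \<tau>). \<beta> i t \<tau>)"
    and \<beta>_range: "\<And>i t \<tau>. i \<in> {1..n} \<Longrightarrow> t \<in> {a..b} \<Longrightarrow> \<tau> \<in> {a..b} \<Longrightarrow> \<beta> i t \<tau> \<in> {real i - 1<..<real i}"
    and L: "C1_slab a b (n+2) L"
    and \<phi>: "C1_slab a b 2 (\<lambda>v. \<phi> (v 1) (v 2))"
    and minimum: "gives_minimum a b n \<alpha> \<beta> \<gamma> L \<phi> xa xa' x T"
    and aT: "a < T" and Tb: "T < b"
begin

section \<open>Admissible functions and the norm of the problem\<close>

lemma variable_order_\<alpha>:
  assumes "i \<in> {1..n}" "a \<le> c" "c \<le> d" "d \<le> b"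
  shows "variable_order c d i (\<alpha> i)"
proof
  show "continuous_on ({c..d} \<times> {c..d}) (\<lambda>(t, \<tau>). \<alpha> i t \<tau>)"
    using assms by (intro continuous_on_subset[OF \<alpha>_continuous[OF assms(1)]]) auto
qed (use assms in \<open>auto intro!: \<alpha>_range simp del: greaterThanLessThan_iff\<close>)

lemma variable_order_\<beta>:
  assumes "i \<in> {1..n}" "a \<le> c" "c \<le> d" "d \<le> b"
  shows "variable_order c d i (\<beta> i)"
proof
  show "continuous_on ({c..d} \<times> {c..d}) (\<lambda>(t, \<tau>). \<beta> i t \<tau>)"
    using assms by (intro continuous_on_subset[OF \<beta>_continuous[OF assms(1)]]) auto
qed (use assms in \<open>auto intro!: \<beta>_range simp del: greaterThanLessThan_iff\<close>)

abbreviation D :: "nat \<Rightarrow> (real \<Rightarrow> real) \<Rightarrow> real \<Rightarrow> real" where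
  "D k \<equiv> nth_deriv {a..b} k"

abbreviation comb :: "nat \<Rightarrow> (real \<Rightarrow> real) \<Rightarrow> real \<Rightarrow> real" where
  "comb i \<equiv> comb_Caputo a b i (\<alpha> i) (\<beta> i) (\<gamma> i)"

text \<open>The combined Caputo operator as a linear operator on the i-th derivative, so that it can
  be applied to any continuous function in place of that derivative.\<close>

definition comb_int :: "nat \<Rightarrow> (real \<Rightarrow> real) \<Rightarrow> real \<Rightarrow> real" where
  "comb_int i g t = fst (\<gamma> i) * left_int i (\<alpha> i) a g t + snd (\<gamma> i) * ((-1)^i * right_int i (\<beta> i) b g t)"

lemma comb_eq: "comb i y = comb_int i (D i y)"
  by (simp add: fun_eq_iff comb_Caputo_def comb_int_def left_Caputo_def right_Caputo_def)

lemma continuous_comb_int: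
  assumes "i \<in> {1..n}" "continuous_on {a..b} g"
  shows "continuous_on {a..b} (comb_int i g)"
proof -
  interpret \<alpha>: variable_order a b i "\<alpha> i" using variable_order_\<alpha>[OF assms(1)] ab by simp
  interpret \<beta>: variable_order a b i "\<beta> i" using variable_order_\<beta>[OF assms(1)] ab by simp
  show ?thesis
    unfolding comb_int_def
    by (intro continuous_intros \<alpha>.continuous_left_int \<beta>.continuous_right_int assms(2))
qed

lemma comb_int_linear:
  assumes i: "i \<in> {1..n}" and f: "continuous_on {a..b} f" and g: "continuous_on {a..b} g"
    and h: "\<And>\<tau>. \<tau> \<in> {a..b} \<Longrightarrow> h \<tau> = f \<tau> + p * g \<tau>" and t: "t \<in> {a..b}"
  shows "comb_int i h t = comb_int i f t + p * comb_int i g t"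
proof -
  interpret \<alpha>: variable_order a b i "\<alpha> i" using variable_order_\<alpha>[OF i] ab by simp
  interpret \<beta>: variable_order a b i "\<beta> i" using variable_order_\<beta>[OF i] ab by simp
  have "left_int i (\<alpha> i) a h t = left_int i (\<alpha> i) a f t + p * left_int i (\<alpha> i) a g t"
    by (rule \<alpha>.left_int_linear[OF f g t]) (rule h)
  moreover have "right_int i (\<beta> i) b h t = right_int i (\<beta> i) b f t + p * right_int i (\<beta> i) b g t"
    by (rule \<beta>.right_int_linear[OF f g t]) (rule h)
  ultimately show ?thesis
    unfolding comb_int_def by (simp add: algebra_simps)
qed

lemma comb_int_scaled:
  assumes i: "i \<in> {1..n}" and g: "continuous_on {a..b} g"
    and h: "\<And>\<tau>. \<tau> \<in> {a..b} \<Longrightarrow> h \<tau> = p * g \<tau>" and t: "t \<in> {a..b}"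
  shows "comb_int i h t = p * comb_int i g t"
  using comb_int_linear[OF i continuous_on_const[of _ 0] g _ t, of h p] h
  by (simp add: comb_int_def left_int_def right_int_def)

text \<open>For a C^n function the kernels are integrated against continuous derivatives, so
  existence and continuity are automatic. Hence every C^n variation is admissible.\<close>

lemma D_set_iff: "(y, S) \<in> D_set a b n \<alpha> \<beta> \<gamma> \<longleftrightarrow> C_on n {a..b} y \<and> S \<in> {a..b}"
proof -
  have "comb_Caputo_exists a b i (\<alpha> i) (\<beta> i) y \<and> continuous_on {a..b} (comb i y)"
    if y: "C_on n {a..b} y" and i: "i \<in> {1..n}" for i
  proof -
    interpret \<alpha>: variable_order a b i "\<alpha> i" using variable_order_\<alpha>[OF i] ab by simp
    interpret \<beta>: variable_order a b i "\<beta> i" using variable_order_\<beta>[OF i] ab by simp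
    have "continuous_on {a..b} (D i y)"
      using i by (intro C_on_continuous_nth_deriv[OF y]) auto
    then show ?thesis
      unfolding comb_eq comb_Caputo_exists_def
      by (intro conjI ballI continuous_comb_int \<alpha>.left_integrable \<beta>.right_integrable i)
  qed
  then show ?thesis unfolding D_set_def by blast
qed

lemma x_C: "C_on n {a..b} x"
  using minimum D_set_iff unfolding gives_minimum_def by blast

text \<open>For comparison with the radius in \<open>gives_minimum\<close>: one B serves all
  multiples p of a fixed chain g of derivatives, so small p and r give a small norm.\<close>

lemma D_norm_bound:
  assumes g: "\<And>i. i \<le> n \<Longrightarrow> continuous_on {a..b} (g i)"
  obtains B where "B \<ge> 0"
    "\<And>z p r. (\<And>i \<tau>. i \<le> n \<Longrightarrow> \<tau> \<in> {a..b} \<Longrightarrow> D i z \<tau> = p * g i \<tau>) \<Longrightarrow>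
        D_norm a b n \<alpha> \<beta> \<gamma> (z, r) \<le> \<bar>p\<bar> * B + \<bar>r\<bar>"
proof -
  have bound: "\<exists>B\<ge>0. \<forall>t\<in>{a..b}. \<bar>f t\<bar> \<le> B" if "continuous_on {a..b} f" for f :: "real \<Rightarrow> real"
  proof -
    have "bounded (f ` {a..b})"
      using that by (intro compact_imp_bounded compact_continuous_image) auto
    then show ?thesis unfolding bounded_pos by (auto intro: less_imp_le)
  qed
  obtain B0 where B0: "B0 \<ge> 0" "\<And>t. t \<in> {a..b} \<Longrightarrow> \<bar>g 0 t\<bar> \<le> B0"
    using bound[OF g[of 0]] by auto
  have "continuous_on {a..b} (\<lambda>t. \<Sum>i=1..n. \<bar>comb_int i (g i) t\<bar>)"
    by (intro continuous_intros continuous_comb_int g) auto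
  from bound[OF this] obtain B1
    where B1: "B1 \<ge> 0" "\<And>t. t \<in> {a..b} \<Longrightarrow> \<bar>\<Sum>i=1..n. \<bar>comb_int i (g i) t\<bar>\<bar> \<le> B1" by auto
  show ?thesis
  proof (rule that[of "B0 + B1"])
    fix z :: "real \<Rightarrow> real" and p r :: real
    assume z: "\<And>i \<tau>. i \<le> n \<Longrightarrow> \<tau> \<in> {a..b} \<Longrightarrow> D i z \<tau> = p * g i \<tau>"
    have "(SUP s\<in>{a..b}. \<bar>z s\<bar>) \<le> \<bar>p\<bar> * B0"
    proof (rule cSUP_least)
      fix s assume s: "s \<in> {a..b}"
      then show "\<bar>z s\<bar> \<le> \<bar>p\<bar> * B0"
        using z[of 0 s] B0(2)[OF s] by (simp add: abs_mult mult_left_mono)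
    qed (use ab in simp)
    moreover have "(SUP s\<in>{a..b}. \<Sum>i=1..n. \<bar>comb i z s\<bar>) \<le> \<bar>p\<bar> * B1"
    proof (rule cSUP_least)
      fix s assume s: "s \<in> {a..b}"
      have "(\<Sum>i=1..n. \<bar>comb i z s\<bar>) = (\<Sum>i=1..n. \<bar>p\<bar> * \<bar>comb_int i (g i) s\<bar>)"
      proof (rule sum.cong[OF refl])
        fix i assume i: "i \<in> {1..n}"
        then have "comb i z s = p * comb_int i (g i) s"
          unfolding comb_eq by (intro comb_int_scaled g z s) auto
        then show "\<bar>comb i z s\<bar> = \<bar>p\<bar> * \<bar>comb_int i (g i) s\<bar>"
          by (simp add: abs_mult)
      qed
      also have "\<dots> = \<bar>p\<bar> * (\<Sum>i=1..n. \<bar>comb_int i (g i) s\<bar>)"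
        by (simp add: sum_distrib_left)
      also have "\<dots> \<le> \<bar>p\<bar> * B1"
        using B1(2)[OF s] by (intro mult_left_mono) auto
      finally show "(\<Sum>i=1..n. \<bar>comb i z s\<bar>) \<le> \<bar>p\<bar> * B1" .
    qed (use ab in simp)
    ultimately show "D_norm a b n \<alpha> \<beta> \<gamma> (z, r) \<le> \<bar>p\<bar> * (B0 + B1) + \<bar>r\<bar>"
      unfolding D_norm_def by (simp add: distrib_left)
  qed (use B0 B1 in simp)
qed

abbreviation u :: "real \<Rightarrow> nat \<Rightarrow> real" where
  "u \<equiv> args a b n \<alpha> \<beta> \<gamma> x"

lemma args_simps:
  "args a b n \<alpha> \<beta> \<gamma> y t (Suc 0) = t" "args a b n \<alpha> \<beta> \<gamma> y t 2 = y t"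
  "i \<in> {1..n} \<Longrightarrow> args a b n \<alpha> \<beta> \<gamma> y t (i + 2) = comb i y t"
  "k \<notin> {1..n+2} \<Longrightarrow> args a b n \<alpha> \<beta> \<gamma> y t k = 0"
  by (auto simp: args_def)

lemma args_index_cases:
  obtains "k = Suc 0" | "k = 2" | i where "i \<in> {1..n}" "k = i + 2" | "k \<notin> {1..n+2}"
proof (cases "k \<in> {3..n+2}")
  case True
  then show ?thesis using that(3)[of "k - 2"] by auto
qed (use that in force)

lemma args_in_slab: "t \<in> {a..b} \<Longrightarrow> u t \<in> slab a b (n+2)"
  unfolding slab_def using args_simps(1,4) by simp

lemma continuous_args: "continuous_on {a..b} (\<lambda>t. u t k)"
proof (cases k rule: args_index_cases)
  case 2
  then show ?thesis using C_on_continuous_nth_deriv[OF x_C, of 0] by (simp add: args_simps)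
next
  case (3 i)
  then have "continuous_on {a..b} (comb i x)"
    unfolding comb_eq by (intro continuous_comb_int C_on_continuous_nth_deriv[OF x_C]) auto
  then show ?thesis unfolding 3(2) args_simps(3)[OF 3(1)] .
qed (simp_all add: args_simps)

lemma continuous_args': "continuous_on {a..b} u"
  by (intro continuous_on_coordinatewise_then_product continuous_args)

abbreviation dL :: "nat \<Rightarrow> real \<Rightarrow> real" where
  "dL \<equiv> partial_L a b n \<alpha> \<beta> \<gamma> L x"

lemma continuous_dL:
  assumes "k \<in> {1..n+2}"
  shows "continuous_on {a..b} (dL k)"
  unfolding partial_L_def
  by (rule continuous_on_compose2[OF conjunct2[OF bspec[OF L[unfolded C1_slab_def] assms]] continuous_args'])
     (use args_in_slab in blast)

section \<open>First-order conditions from moving the end time and from moving the function\<close>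

definition end_pt :: "nat \<Rightarrow> real" where
  "end_pt = (\<lambda>k. if k = 1 then T else if k = 2 then x T else 0)"

lemma end_pt_in_slab: "end_pt \<in> slab a b 2"
  unfolding slab_def end_pt_def using aT Tb by simp

lemma \<phi>_deriv2: "(\<phi> T has_real_derivative partial_deriv (slab a b 2) 2 (\<lambda>v. \<phi> (v 1) (v 2)) end_pt) (at (x T))"
  using C1_slab_partial_deriv[OF \<phi> end_pt_in_slab, of 2] slab_section[OF end_pt_in_slab, of 2]
  by (simp add: end_pt_def has_real_derivative_iff_has_vector_derivative)

text \<open>The slab gives a derivative within \<open>{a..b}\<close>; T is interior, so it is the
  two-sided one that \<open>deriv\<close> denotes.\<close>

lemma \<phi>_deriv1: "((\<lambda>s. \<phi> s (x T)) has_real_derivative partial_deriv (slab a b 2) 1 (\<lambda>v. \<phi> (v 1) (v 2)) end_pt) (at T)"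
  using C1_slab_partial_deriv[OF \<phi> end_pt_in_slab, of 1] slab_section[OF end_pt_in_slab, of 1] aT Tb
  by (simp add: end_pt_def has_real_derivative_iff_has_vector_derivative at_within_Icc_at)

text \<open>With x fixed, the functional of the end time S alone is differentiable at the interior
  point T and has a local minimum there.\<close>

lemma transversality_time:
  "L (u T) + deriv (\<lambda>s. \<phi> s (x T)) T + deriv (\<phi> T) (x T) * D 1 x T = 0"
proof -
  let ?J = "\<lambda>S. J_fun a b n \<alpha> \<beta> \<gamma> L \<phi> x S"
  have T: "T \<in> {a..b}" using aT Tb by simp
  have cL: "continuous_on {a..b} (\<lambda>t. L (u t))"
    by (rule continuous_on_compose2[OF C1_slab_continuous_on[OF L] continuous_args'])
       (use args_in_slab in blast)
  have 1: "((\<lambda>S. integral {a..S} (\<lambda>t. L (u t))) has_vector_derivative L (u T)) (at T within {a..b})"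
    using cL T by (rule integral_has_vector_derivative)
  have dx: "(x has_vector_derivative D 1 x T) (at T within {a..b})"
    using C_on_has_vector_derivative[OF x_C _ T, of 0] n by simp
  define p where "p = (\<lambda>S k. if k = 1 then S else if k = (2::nat) then x S else 0)"
  define p' where "p' = (\<lambda>k. if k = 1 then 1 else if k = (2::nat) then D 1 x T else 0)"
  have "((\<lambda>S. (\<lambda>v. \<phi> (v 1) (v 2)) (p S)) has_vector_derivative
      (\<Sum>k=1..2. p' k * partial_deriv (slab a b 2) k (\<lambda>v. \<phi> (v 1) (v 2)) (p T))) (at T within {a..b})"
  proof (rule C1_slab_chain_rule[OF \<phi>])
    show "p S \<in> slab a b 2" if "S \<in> {a..b}" for S
      unfolding slab_def p_def using that by simp
    show "((\<lambda>S. p S l) has_vector_derivative p' l) (at T within {a..b})" for l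
      unfolding p_def p'_def using dx by (auto intro!: derivative_eq_intros)
  qed (rule T)
  moreover have "p T = end_pt" by (simp add: p_def end_pt_def)
  ultimately have 2: "((\<lambda>S. \<phi> S (x S)) has_vector_derivative
      deriv (\<lambda>s. \<phi> s (x T)) T + D 1 x T * deriv (\<phi> T) (x T)) (at T within {a..b})"
    using DERIV_imp_deriv[OF \<phi>_deriv1] DERIV_imp_deriv[OF \<phi>_deriv2]
    by (simp add: p_def p'_def numeral_2_eq_2)
  have "(?J has_real_derivative L (u T) + (deriv (\<lambda>s. \<phi> s (x T)) T + D 1 x T * deriv (\<phi> T) (x T))) (at T)"
    using has_vector_derivative_add[OF 1 2] aT Tb
    by (simp add: J_fun_def has_real_derivative_iff_has_vector_derivative at_within_Icc_at)
  moreover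
  obtain e where e: "e > 0" "\<And>y S. (y, S) \<in> D_set a b n \<alpha> \<beta> \<gamma> \<Longrightarrow> initial_conds a b n xa xa' y \<Longrightarrow>
        D_norm a b n \<alpha> \<beta> \<gamma> (\<lambda>t. y t - x t, S - T) < e \<Longrightarrow> ?J T \<le> J_fun a b n \<alpha> \<beta> \<gamma> L \<phi> y S"
    and ic: "initial_conds a b n xa xa' x"
    using minimum unfolding gives_minimum_def by blast
  \<comment> \<open>With x unchanged the difference is the zero function, so p = 0 and the norm
    bound reduces to the distance of S from T.\<close>
  obtain B where B: "\<And>z p r. (\<And>i \<tau>. i \<le> n \<Longrightarrow> \<tau> \<in> {a..b} \<Longrightarrow> D i z \<tau> = p * 0) \<Longrightarrow>
        D_norm a b n \<alpha> \<beta> \<gamma> (z, r) \<le> \<bar>p\<bar> * B + \<bar>r\<bar>"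
    using D_norm_bound[of "\<lambda>i t. 0"] by (metis continuous_on_const)
  have D0: "D i (\<lambda>t. 0) \<tau> = 0 * 0" if "i \<le> n" "\<tau> \<in> {a..b}" for i \<tau>
    using nth_deriv_chain[OF ab, of n "\<lambda>k t. 0" "\<lambda>t. 0" i \<tau>] that by simp
  \<comment> \<open>The radius also keeps S inside \<open>{a..b}\<close>.\<close>
  have min: "?J T \<le> ?J S" if "\<bar>T - S\<bar> < min e (min (T - a) (b - T))" for S
  proof (rule e(2))
    show "(x, S) \<in> D_set a b n \<alpha> \<beta> \<gamma>"
      using that x_C by (simp add: D_set_iff abs_less_iff)
    show "D_norm a b n \<alpha> \<beta> \<gamma> (\<lambda>t. x t - x t, S - T) < e"
      using B[of "\<lambda>t. 0" 0 "S - T", OF D0] that by (simp add: abs_minus_commute)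
  qed (rule ic)
  ultimately have "L (u T) + (deriv (\<lambda>s. \<phi> s (x T)) T + D 1 x T * deriv (\<phi> T) (x T)) = 0"
    using aT Tb e(1) by (intro DERIV_local_min[of ?J _ T "min e (min (T - a) (b - T))"]) auto
  then show ?thesis by (simp add: algebra_simps)
qed

text \<open>\<open>H i\<close> is the i-th derivative of the variation \<open>H 0\<close>, and
  \<open>H n\<close> is g. With T fixed, the functional along x + e h has a local minimum at e =
  0.\<close>

lemma first_variation:
  assumes g: "continuous_on {a..b} g"
  defines "H \<equiv> \<lambda>i. (antideriv a ^^ (n - i)) g"
  shows "integral {a..T} (\<lambda>t. H 0 t * dL 2 t + (\<Sum>i=1..n. comb_int i (H i) t * dL (i + 2) t))
    + deriv (\<phi> T) (x T) * H 0 T = 0"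
proof -
  have T: "T \<in> {a..b}" using aT Tb by simp
  have cH: "continuous_on {a..b} (H i)" for i
    unfolding H_def by (rule continuous_on_antideriv_pow[OF g])
  have H_Suc: "H i = antideriv a (H (Suc i))" if "i < n" for i
  proof -
    have "n - i = Suc (n - Suc i)" using that by simp
    then show ?thesis unfolding H_def by (simp only: funpow.simps comp_apply)
  qed
  have dH: "(H i has_vector_derivative H (Suc i) t) (at t within {a..b})" if "i < n" "t \<in> {a..b}" for i t
    unfolding H_Suc[OF that(1)] using cH that(2) by (rule antideriv_has_vector_derivative)
  define y where "y = (\<lambda>e t. x t + e * H 0 t)"
  have dy: "((\<lambda>t. D k x t + e * H k t) has_vector_derivative D (Suc k) x t + e * H (Suc k) t) (at t within {a..b})"
    if "k < n" "t \<in> {a..b}" for e k t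
    using C_on_has_vector_derivative[OF x_C that] dH[OF that]
    by (intro has_vector_derivative_add has_vector_derivative_mult_right)
  have y_C: "C_on n {a..b} (y e)" for e
    using dy C_on_continuous_nth_deriv[OF x_C order_refl] cH
    by (intro C_on_chain[OF ab, of n "\<lambda>k t. D k x t + e * H k t"] continuous_intros) (simp_all add: y_def)
  have Dy: "D k (y e) t = D k x t + e * H k t" if "k \<le> n" "t \<in> {a..b}" for k e t
    using dy that by (intro nth_deriv_chain[OF ab, of n "\<lambda>k t. D k x t + e * H k t"]) (simp_all add: y_def)
  \<comment> \<open>The derivative of the argument vector in e; its time component is 0.\<close>
  define w where "w = (\<lambda>t k. if k = 2 then H 0 t else if k \<in> {3..n+2} then comb_int (k-2) (H (k-2)) t else 0)"
  have w_simps: "w t (Suc 0) = 0" "w t 2 = H 0 t" "i \<in> {1..n} \<Longrightarrow> w t (i + 2) = comb_int i (H i) t"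
     "k \<notin> {2..n+2} \<Longrightarrow> w t k = 0" "k \<notin> {1..n+2} \<Longrightarrow> w t k = 0" for t i k
    by (auto simp: w_def)
  have args_y: "args a b n \<alpha> \<beta> \<gamma> (y e) t k = u t k + e * w t k" if t: "t \<in> {a..b}" for e t k
  proof (cases k rule: args_index_cases)
    case (3 i)
    have "comb i (y e) t = comb i x t + e * comb_int i (H i) t"
      unfolding comb_eq using 3(1) t
      by (intro comb_int_linear C_on_continuous_nth_deriv[OF x_C] cH Dy) auto
    then show ?thesis
      unfolding 3(2) args_simps(3)[OF 3(1)] w_simps(3)[OF 3(1)] .
  qed (simp_all add: args_simps w_simps y_def)
  have cw: "continuous_on {a..b} (\<lambda>t. w t k)" for k
  proof (cases k rule: args_index_cases)
    case (3 i)
    show ?thesis unfolding 3(2) w_simps(3)[OF 3(1)] by (rule continuous_comb_int[OF 3(1) cH])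
  qed (simp_all add: w_simps cH)
  let ?I = "integral {a..T} (\<lambda>t. \<Sum>k=1..n+2. w t k * dL k t)"
  have sub: "{a..T} \<subseteq> {a..b}" using Tb by simp
  have "((\<lambda>e. integral {a..T} (\<lambda>t. L (\<lambda>k. u t k + e * w t k))) has_real_derivative ?I) (at 0)"
    unfolding has_real_derivative_iff_has_vector_derivative partial_L_def
    using sub by (intro first_variation_integral[OF L] args_in_slab w_simps continuous_on_subset[OF continuous_args]
      continuous_on_subset[OF cw]) auto
  moreover have "((\<lambda>e. \<phi> T (x T + e * H 0 T)) has_real_derivative deriv (\<phi> T) (x T) * H 0 T) (at 0)"
    by (rule DERIV_chain2[of "\<phi> T"])
       (use \<phi>_deriv2 DERIV_imp_deriv[OF \<phi>_deriv2] in \<open>auto intro!: derivative_eq_intros\<close>)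
  ultimately have "((\<lambda>e. integral {a..T} (\<lambda>t. L (\<lambda>k. u t k + e * w t k)) + \<phi> T (x T + e * H 0 T))
      has_real_derivative ?I + deriv (\<phi> T) (x T) * H 0 T) (at 0)"
    by (rule DERIV_add)
  moreover have "integral {a..T} (\<lambda>t. L (\<lambda>k. u t k + e * w t k)) + \<phi> T (x T + e * H 0 T) =
      J_fun a b n \<alpha> \<beta> \<gamma> L \<phi> (y e) T" for e
  proof -
    have "integral {a..T} (\<lambda>t. L (\<lambda>k. u t k + e * w t k)) = integral {a..T} (\<lambda>t. L (args a b n \<alpha> \<beta> \<gamma> (y e) t))"
      using sub by (intro integral_cong arg_cong[of _ _ L] ext args_y[symmetric]) auto
    then show ?thesis by (simp add: J_fun_def y_def)
  qed
  ultimately have dJ: "((\<lambda>e. J_fun a b n \<alpha> \<beta> \<gamma> L \<phi> (y e) T)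
      has_real_derivative ?I + deriv (\<phi> T) (x T) * H 0 T) (at 0)"
    by simp
  obtain \<epsilon> where e: "\<epsilon> > 0" "\<And>y S. (y, S) \<in> D_set a b n \<alpha> \<beta> \<gamma> \<Longrightarrow> initial_conds a b n xa xa' y \<Longrightarrow>
        D_norm a b n \<alpha> \<beta> \<gamma> (\<lambda>t. y t - x t, S - T) < \<epsilon> \<Longrightarrow>
        J_fun a b n \<alpha> \<beta> \<gamma> L \<phi> x T \<le> J_fun a b n \<alpha> \<beta> \<gamma> L \<phi> y S"
    and ic: "initial_conds a b n xa xa' x"
    using minimum unfolding gives_minimum_def by blast
  obtain B where B: "B \<ge> 0" "\<And>z p r. (\<And>i \<tau>. i \<le> n \<Longrightarrow> \<tau> \<in> {a..b} \<Longrightarrow> D i z \<tau> = p * H i \<tau>) \<Longrightarrow>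
        D_norm a b n \<alpha> \<beta> \<gamma> (z, r) \<le> \<bar>p\<bar> * B + \<bar>r\<bar>"
    by (rule D_norm_bound[of H]) (use cH in blast)+
  have DH: "D i (\<lambda>t. e * H 0 t) \<tau> = e * H i \<tau>" if "i \<le> n" "\<tau> \<in> {a..b}" for e i \<tau>
    using that dH by (intro nth_deriv_chain[OF ab, of n "\<lambda>i t. e * H i t"] has_vector_derivative_mult_right) auto
  \<comment> \<open>Exactly the derivatives of orders 0 to n - 1 vanish by construction; these are
    the orders fixed by the initial conditions.\<close>
  have H0: "H i a = 0" if "i < n" for i
    unfolding H_Suc[OF that] by (rule antideriv_at_base)
  \<comment> \<open>The radius comes from \<open>D_norm_bound\<close>; B + 1 in place of B keeps the
    denominator positive.\<close>
  have "J_fun a b n \<alpha> \<beta> \<gamma> L \<phi> (y 0) T \<le> J_fun a b n \<alpha> \<beta> \<gamma> L \<phi> (y p) T" if "\<bar>0 - p\<bar> < \<epsilon> / (B + 1)" for p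
  proof -
    have "J_fun a b n \<alpha> \<beta> \<gamma> L \<phi> x T \<le> J_fun a b n \<alpha> \<beta> \<gamma> L \<phi> (y p) T"
    proof (rule e(2))
      show "(y p, T) \<in> D_set a b n \<alpha> \<beta> \<gamma>"
        using y_C T by (simp add: D_set_iff)
      have "y p a = x a"
        using H0[of 0] n by (simp add: y_def)
      moreover have "D i (y p) a = D i x a" if "i \<in> {1..n-1}" for i
      proof -
        have "i < n" using that n by auto
        then show ?thesis using Dy[of i a p] H0[of i] ab by simp
      qed
      ultimately show "initial_conds a b n xa xa' (y p)"
        using ic by (simp add: initial_conds_def)
      have "D_norm a b n \<alpha> \<beta> \<gamma> (\<lambda>t. p * H 0 t, 0) \<le> \<bar>p\<bar> * B + \<bar>0\<bar>"
        by (rule B(2)) (rule DH)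
      also have "\<dots> \<le> \<bar>p\<bar> * (B + 1)"
        by (simp add: distrib_left)
      also have "\<dots> < \<epsilon>"
        using that B(1) by (simp add: field_simps)
      finally show "D_norm a b n \<alpha> \<beta> \<gamma> (\<lambda>t. y p t - x t, T - T) < \<epsilon>"
        by (simp add: y_def)
    qed
    then show ?thesis by (simp add: y_def)
  qed
  then have "?I + deriv (\<phi> T) (x T) * H 0 T = 0"
    using e(1) B(1) by (intro DERIV_local_min[OF dJ, of "\<epsilon> / (B + 1)"]) auto
  moreover have "(\<Sum>k=1..n+2. w t k * dL k t) =
      H 0 t * dL 2 t + (\<Sum>i=1..n. comb_int i (H i) t * dL (i + 2) t)" for t
  proof -
    have "(\<Sum>k=1..n+2. w t k * dL k t) = w t 1 * dL 1 t + (w t 2 * dL 2 t + (\<Sum>k=3..n+2. w t k * dL k t))"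
    proof -
      have "{1..n+2} = insert 1 (insert 2 {3..n+2})" by auto
      then show ?thesis by simp
    qed
    also have "(\<Sum>k=3..n+2. w t k * dL k t) = (\<Sum>i=1..n. w t (i + 2) * dL (i + 2) t)"
    proof -
      have "{3..n+2} = {1+2..n+2}" by simp
      then show ?thesis by (simp only: sum.shift_bounds_cl_nat_ivl)
    qed
    also have "\<dots> = (\<Sum>i=1..n. comb_int i (H i) t * dL (i + 2) t)"
      by (intro sum.cong refl arg_cong2[of _ _ _ _ "(*)"] w_simps(3))
    finally show ?thesis by (simp add: w_simps)
  qed
  ultimately show ?thesis by simp
qed

section \<open>Fractional integration by parts in the first variation\<close>

abbreviation aI :: "nat \<Rightarrow> real \<Rightarrow> real" where "aI i \<equiv> left_int i (\<beta> i) a (dL (i + 2))"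
abbreviation TI :: "nat \<Rightarrow> real \<Rightarrow> real" where "TI i \<equiv> left_int i (\<beta> i) T (dL (i + 2))"
abbreviation IT :: "nat \<Rightarrow> real \<Rightarrow> real" where "IT i \<equiv> right_int i (\<alpha> i) T (dL (i + 2))"

lemma continuous_aI: "i \<in> {1..n} \<Longrightarrow> continuous_on {a..b} (aI i)"
  using ab by (intro variable_order.continuous_left_int variable_order_\<beta> continuous_dL) auto

lemma continuous_TI: "i \<in> {1..n} \<Longrightarrow> continuous_on {T..b} (TI i)"
  using aT Tb by (intro variable_order.continuous_left_int variable_order_\<beta> continuous_on_subset[OF continuous_dL]) auto

lemma continuous_IT: "i \<in> {1..n} \<Longrightarrow> continuous_on {a..T} (IT i)"
  using aT Tb by (intro variable_order.continuous_right_int variable_order_\<alpha> continuous_on_subset[OF continuous_dL]) auto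

text \<open>The coefficients of the \<open>i\<close>-th derivative of the variation on \<open>[a,T]\<close> and on \<open>[T,b]\<close>.\<close>

definition Nl :: "nat \<Rightarrow> real \<Rightarrow> real" where
  "Nl i = (if i = 0 then dL 2 else (\<lambda>t. fst (\<gamma> i) * IT i t + (-1)^i * snd (\<gamma> i) * aI i t))"

definition Nr :: "nat \<Rightarrow> real \<Rightarrow> real" where
  "Nr i = (if i = 0 then (\<lambda>t. 0) else
     (\<lambda>t. (-1)^i * snd (\<gamma> i) * aI i t + - ((-1)^i * snd (\<gamma> i)) * TI i t))"

lemma continuous_Nl:
  assumes "i \<le> n"
  shows "continuous_on {a..T} (Nl i)"
proof (cases "i = 0")
  case True
  then show ?thesis
    using Tb by (auto simp: Nl_def intro!: continuous_on_subset[OF continuous_dL])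
next
  case False
  then have i: "i \<in> {1..n}" using assms by simp
  have "{a..T} \<subseteq> {a..b}" using Tb by simp
  then have "continuous_on {a..T} (\<lambda>t. fst (\<gamma> i) * IT i t + (-1)^i * snd (\<gamma> i) * aI i t)"
    by (intro continuous_on_add continuous_on_mult_left continuous_IT[OF i] continuous_on_subset[OF continuous_aI[OF i]])
  with False show ?thesis by (simp only: Nl_def if_False)
qed

lemma continuous_Nr:
  assumes "i \<le> n"
  shows "continuous_on {T..b} (Nr i)"
proof (cases "i = 0")
  case False
  then have i: "i \<in> {1..n}" using assms by simp
  have "{T..b} \<subseteq> {a..b}" using aT by simp
  then have "continuous_on {T..b} (\<lambda>t. (-1)^i * snd (\<gamma> i) * aI i t + - ((-1)^i * snd (\<gamma> i)) * TI i t)"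
    by (intro continuous_on_add continuous_on_mult_left continuous_TI[OF i] continuous_on_subset[OF continuous_aI[OF i]])
  with False show ?thesis by (simp only: Nr_def if_False)
qed (simp add: Nr_def)

text \<open>The left operator at t in \<open>{a..T}\<close> sees g only up to t, so its adjoint on
  \<open>{a..T}\<close> is \<open>IT\<close>. The right operator sees g up to b: its pairing over
  \<open>{a..T}\<close> is the pairing over \<open>{a..b}\<close>, with adjoint \<open>aI\<close>,
  minus the one over \<open>{T..b}\<close>, with adjoint \<open>TI\<close>. This leaves
  \<open>aI\<close> on \<open>{a..T}\<close> and \<open>aI\<close> minus \<open>TI\<close> on
  \<open>{T..b}\<close>.\<close>

lemma comb_int_by_parts:
  assumes i: "i \<in> {1..n}" and g: "continuous_on {a..b} g"
  shows "integral {a..T} (\<lambda>t. comb_int i g t * dL (i + 2) t) =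
    integral {a..T} (\<lambda>t. g t * Nl i t) + integral {T..b} (\<lambda>t. g t * Nr i t)"
proof -
  let ?f = "dL (i + 2)" and ?R = "right_int i (\<beta> i) b g" and ?l = "left_int i (\<alpha> i) a g"
  have sub: "{a..T} \<subseteq> {a..b}" "{T..b} \<subseteq> {a..b}" using aT Tb by auto
  have f: "continuous_on {a..b} ?f" using i by (intro continuous_dL) auto
  interpret \<alpha>: variable_order a T i "\<alpha> i" using variable_order_\<alpha>[OF i] aT Tb by simp
  interpret \<beta>: variable_order a b i "\<beta> i" using variable_order_\<beta>[OF i] aT Tb by simp
  interpret \<beta>T: variable_order T b i "\<beta> i" using variable_order_\<beta>[OF i] aT Tb by simp
  note on = continuous_on_subset[OF _ sub(1)] continuous_on_subset[OF _ sub(2)]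
  have cR: "continuous_on {a..b} ?R" by (rule \<beta>.continuous_right_int[OF g])
  have cl: "continuous_on {a..T} ?l" by (rule \<alpha>.continuous_left_int[OF on(1)[OF g]])
  note ci = integrable_continuous_real continuous_intros
  have 1: "integral {a..T} (\<lambda>t. ?f t * ?l t) = integral {a..T} (\<lambda>t. g t * IT i t)"
    by (intro \<alpha>.fractional_integration_by_parts on(1) f g)
  have 2: "integral {a..b} (\<lambda>t. ?f t * ?R t) = integral {a..b} (\<lambda>t. g t * aI i t)"
    using \<beta>.fractional_integration_by_parts[OF g f] by simp
  have 3: "integral {T..b} (\<lambda>t. ?f t * ?R t) = integral {T..b} (\<lambda>t. g t * TI i t)"
    using \<beta>T.fractional_integration_by_parts[OF on(2)[OF g] on(2)[OF f]] by simp
  have split: "integral {a..b} (\<lambda>t. p t * q t) = integral {a..T} (\<lambda>t. p t * q t) + integral {T..b} (\<lambda>t. p t * q t)"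
    if "continuous_on {a..b} p" "continuous_on {a..b} q" for p q :: "real \<Rightarrow> real"
    using aT Tb that by (intro Henstock_Kurzweil_Integration.integral_combine[symmetric] ci) auto
  have c: "continuous_on {a..b} (aI i)" "continuous_on {T..b} (TI i)" "continuous_on {a..T} (IT i)"
    using continuous_aI continuous_TI continuous_IT i by auto
  have "integral {a..T} (\<lambda>t. comb_int i g t * ?f t) =
     integral {a..T} (\<lambda>t. fst (\<gamma> i) * (?f t * ?l t) + (-1)^i * snd (\<gamma> i) * (?f t * ?R t))"
    by (simp add: comb_int_def algebra_simps)
  also have "\<dots> = integral {a..T} (\<lambda>t. fst (\<gamma> i) * (?f t * ?l t))
      + integral {a..T} (\<lambda>t. (-1)^i * snd (\<gamma> i) * (?f t * ?R t))"
    by (intro integral_add ci cl on(1) f cR)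
  also have "\<dots> = fst (\<gamma> i) * integral {a..T} (\<lambda>t. ?f t * ?l t)
      + (-1)^i * snd (\<gamma> i) * integral {a..T} (\<lambda>t. ?f t * ?R t)"
    by (simp only: integral_mult_right)
  also have "\<dots> = fst (\<gamma> i) * integral {a..T} (\<lambda>t. g t * IT i t) + (-1)^i * snd (\<gamma> i) *
      (integral {a..T} (\<lambda>t. g t * aI i t) + integral {T..b} (\<lambda>t. g t * aI i t) - integral {T..b} (\<lambda>t. g t * TI i t))"
    using 1 2 3 split[OF f cR] split[OF g c(1)] by simp
  also have "\<dots> = integral {a..T} (\<lambda>t. fst (\<gamma> i) * (g t * IT i t) + (-1)^i * snd (\<gamma> i) * (g t * aI i t))
     + integral {T..b} (\<lambda>t. (-1)^i * snd (\<gamma> i) * (g t * aI i t - g t * TI i t))"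
  proof -
    have "integral {a..T} (\<lambda>t. fst (\<gamma> i) * (g t * IT i t) + (-1)^i * snd (\<gamma> i) * (g t * aI i t)) =
      integral {a..T} (\<lambda>t. fst (\<gamma> i) * (g t * IT i t)) + integral {a..T} (\<lambda>t. (-1)^i * snd (\<gamma> i) * (g t * aI i t))"
      by (intro integral_add ci c on(1) g)
    moreover have "integral {T..b} (\<lambda>t. g t * aI i t - g t * TI i t) =
        integral {T..b} (\<lambda>t. g t * aI i t) - integral {T..b} (\<lambda>t. g t * TI i t)"
      by (intro integral_diff ci c(2) on(2) c(1) g)
    ultimately show ?thesis
      by (simp only: integral_mult_right) (simp add: algebra_simps)
  qed
  also have "\<dots> = integral {a..T} (\<lambda>t. g t * Nl i t) + integral {T..b} (\<lambda>t. g t * Nr i t)"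
    using i by (simp add: Nl_def Nr_def algebra_simps)
  finally show ?thesis .
qed

text \<open>The hypothesis of \<open>free_end_variation\<close>, with
  \<open>deriv (\<phi> T) (x T)\<close> as the cost c.\<close>

lemma first_variation_by_parts:
  assumes g: "continuous_on {a..b} g"
  shows "(\<Sum>i\<le>n. integral {a..T} (\<lambda>t. (antideriv a ^^ (n-i)) g t * Nl i t)
             + integral {T..b} (\<lambda>t. (antideriv a ^^ (n-i)) g t * Nr i t))
       + deriv (\<phi> T) (x T) * (antideriv a ^^ n) g T = 0"
proof -
  let ?H = "\<lambda>i. (antideriv a ^^ (n - i)) g"
  have cH: "continuous_on {a..b} (?H i)" for i
    by (rule continuous_on_antideriv_pow[OF g])
  have sub: "{a..T} \<subseteq> {a..b}" using Tb by simp
  have c0: "continuous_on {a..T} (\<lambda>t. ?H 0 t * dL 2 t)"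
    by (intro continuous_intros continuous_on_subset[OF cH sub] continuous_on_subset[OF continuous_dL sub]) auto
  have c: "continuous_on {a..T} (\<lambda>t. comb_int i (?H i) t * dL (i + 2) t)" if "i \<in> {1..n}" for i
    using that by (intro continuous_intros continuous_on_subset[OF continuous_comb_int[OF _ cH] sub]
      continuous_on_subset[OF continuous_dL sub]) auto
  have "integral {a..T} (\<lambda>t. ?H 0 t * dL 2 t + (\<Sum>i=1..n. comb_int i (?H i) t * dL (i + 2) t)) =
    integral {a..T} (\<lambda>t. ?H 0 t * dL 2 t) + integral {a..T} (\<lambda>t. \<Sum>i=1..n. comb_int i (?H i) t * dL (i + 2) t)"
    by (intro integral_add integrable_continuous_real c0 continuous_on_sum c)
  also have "integral {a..T} (\<lambda>t. \<Sum>i=1..n. comb_int i (?H i) t * dL (i + 2) t) =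
     (\<Sum>i=1..n. integral {a..T} (\<lambda>t. comb_int i (?H i) t * dL (i + 2) t))"
    by (intro integral_sum integrable_continuous_real c) auto
  also have "\<dots> = (\<Sum>i=1..n. integral {a..T} (\<lambda>t. ?H i t * Nl i t) + integral {T..b} (\<lambda>t. ?H i t * Nr i t))"
    by (intro sum.cong refl comb_int_by_parts cH)
  finally have "integral {a..T} (\<lambda>t. ?H 0 t * dL 2 t + (\<Sum>i=1..n. comb_int i (?H i) t * dL (i + 2) t)) =
     (\<Sum>i\<le>n. integral {a..T} (\<lambda>t. ?H i t * Nl i t) + integral {T..b} (\<lambda>t. ?H i t * Nr i t))"
    by (simp add: atMost_atLeast0 sum.atLeast_Suc_atMost[of 0 n] Nl_def Nr_def)
  with first_variation[OF g] show ?thesis by simp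
qed

section \<open>Costate formulas and the necessary conditions\<close>

lemma minus_one_cancel: "(-1::real) ^ i * ((-1) ^ i * z) = z"
  by (simp flip: mult.assoc power_mult_distrib)

lemma minus_one_diff:
  assumes "k \<le> i"
  shows "(-1::real) ^ (i - k) * (-1) ^ i = (-1) ^ k"
proof -
  have "i - k + i = 2 * (i - k) + k" using assms by simp
  then have "(-1::real) ^ (i - k) * (-1) ^ i = (-1) ^ (2 * (i - k) + k)"
    by (simp only: flip: power_add)
  also have "\<dots> = (-1) ^ k"
    by (simp add: power_add power_mult)
  finally show ?thesis .
qed

text \<open>k is the costate index: evaluating \<open>e k\<close> at t takes derivatives of order i
  - k of the fractional integrals with index i.\<close>

abbreviation left_smooth :: "nat \<Rightarrow> nat \<Rightarrow> real \<Rightarrow> bool" where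
  "left_smooth k i t \<equiv> (fst (\<gamma> i) \<noteq> 0 \<longrightarrow> nth_differentiable_at {a..T} (i - k) (IT i) t) \<and>
     (snd (\<gamma> i) \<noteq> 0 \<longrightarrow> nth_differentiable_at {a..b} (i - k) (aI i) t)"

abbreviation right_smooth :: "nat \<Rightarrow> nat \<Rightarrow> real \<Rightarrow> bool" where
  "right_smooth k i t \<equiv> snd (\<gamma> i) \<noteq> 0 \<longrightarrow> nth_differentiable_at {a..b} (i - k) (aI i) t \<and>
     nth_differentiable_at {T..b} (i - k) (TI i) t"

lemma nth_deriv_Nl:
  assumes "i \<ge> 1" "t \<in> {a..T}" "left_smooth k i t"
  shows "nth_differentiable_at {a..T} (i - k) (Nl i) t \<and>
    nth_deriv {a..T} (i - k) (Nl i) t =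
      fst (\<gamma> i) * nth_deriv {a..T} (i - k) (IT i) t + (-1)^i * snd (\<gamma> i) * D (i - k) (aI i) t"
proof -
  have sub: "{a..T} \<subseteq> {a..b}" using Tb by simp
  have N: "Nl i = (\<lambda>t. fst (\<gamma> i) * IT i t + (-1)^i * snd (\<gamma> i) * aI i t)"
    using assms(1) by (simp only: Nl_def) simp
  have r: "snd (\<gamma> i) \<noteq> 0 \<Longrightarrow> nth_differentiable_at {a..T} (i - k) (aI i) t \<and>
      nth_deriv {a..T} (i - k) (aI i) t = D (i - k) (aI i) t"
    using assms by (intro nth_deriv_subinterval[OF aT sub]) auto
  have "nth_differentiable_at {a..T} (i - k) (Nl i) t \<and>
    nth_deriv {a..T} (i - k) (Nl i) t =
      fst (\<gamma> i) * nth_deriv {a..T} (i - k) (IT i) t + (-1)^i * snd (\<gamma> i) * nth_deriv {a..T} (i - k) (aI i) t"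
    unfolding N by (rule nth_deriv_lincomb[OF aT assms(2)]) (use assms r in auto)
  with r show ?thesis by (cases "snd (\<gamma> i) = 0") simp_all
qed

lemma nth_deriv_Nr:
  assumes "i \<ge> 1" "t \<in> {T..b}" "right_smooth k i t"
  shows "nth_differentiable_at {T..b} (i - k) (Nr i) t \<and>
    nth_deriv {T..b} (i - k) (Nr i) t =
      (-1)^i * snd (\<gamma> i) * (D (i - k) (aI i) t - nth_deriv {T..b} (i - k) (TI i) t)"
proof -
  have sub: "{T..b} \<subseteq> {a..b}" using aT by simp
  have N: "Nr i = (\<lambda>t. (-1)^i * snd (\<gamma> i) * aI i t + - ((-1)^i * snd (\<gamma> i)) * TI i t)"
    using assms(1) by (simp only: Nr_def) simp
  have r: "snd (\<gamma> i) \<noteq> 0 \<Longrightarrow> nth_differentiable_at {T..b} (i - k) (aI i) t \<and>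
      nth_deriv {T..b} (i - k) (aI i) t = D (i - k) (aI i) t"
    using assms by (intro nth_deriv_subinterval[OF Tb sub]) auto
  have "nth_differentiable_at {T..b} (i - k) (Nr i) t \<and>
    nth_deriv {T..b} (i - k) (Nr i) t =
      (-1)^i * snd (\<gamma> i) * nth_deriv {T..b} (i - k) (aI i) t + - ((-1)^i * snd (\<gamma> i)) * nth_deriv {T..b} (i - k) (TI i) t"
    unfolding N by (rule nth_deriv_lincomb[OF Tb assms(2)]) (use assms r in auto)
  with r show ?thesis by (cases "snd (\<gamma> i) = 0") (simp_all add: algebra_simps)
qed

text \<open>The formulas for index 0 are stated separately, with \<open>el 0\<close> and
  \<open>er 0\<close> already replaced by 0, because the coefficient of index 0 is
  \<open>dL 2\<close> or 0 and not a combination of fractional integrals.\<close>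

lemma costates:
  obtains el er where
    "\<And>k t. 1 \<le> k \<Longrightarrow> k \<le> n \<Longrightarrow> t \<in> {a..T} \<Longrightarrow> (\<And>i. i \<in> {k..n} \<Longrightarrow> left_smooth k i t) \<Longrightarrow>
      el k t = - (\<Sum>i=k..n. (-1)^(i-k) * (fst (\<gamma> i) * nth_deriv {a..T} (i - k) (IT i) t + (-1)^i * snd (\<gamma> i) * D (i - k) (aI i) t))"
    "\<And>k t. 1 \<le> k \<Longrightarrow> k \<le> n \<Longrightarrow> t \<in> {T..b} \<Longrightarrow> (\<And>i. i \<in> {k..n} \<Longrightarrow> right_smooth k i t) \<Longrightarrow>
      er k t = - (\<Sum>i=k..n. (-1)^(i-k) * ((-1)^i * snd (\<gamma> i) * (D (i - k) (aI i) t - nth_deriv {T..b} (i - k) (TI i) t)))"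
    "\<And>t. t \<in> {a..T} \<Longrightarrow> (\<And>i. i \<in> {1..n} \<Longrightarrow> left_smooth 0 i t) \<Longrightarrow>
      dL 2 t + (\<Sum>i=1..n. (-1)^i * (fst (\<gamma> i) * nth_deriv {a..T} i (IT i) t + (-1)^i * snd (\<gamma> i) * D i (aI i) t)) = 0"
    "\<And>t. t \<in> {T..b} \<Longrightarrow> (\<And>i. i \<in> {1..n} \<Longrightarrow> right_smooth 0 i t) \<Longrightarrow>
      (\<Sum>i=1..n. (-1)^i * ((-1)^i * snd (\<gamma> i) * (D i (aI i) t - nth_deriv {T..b} i (TI i) t))) = 0"
    "\<And>k. er k b = 0" "el 1 T = er 1 T + deriv (\<phi> T) (x T)" "\<And>k. k \<ge> 2 \<Longrightarrow> el k T = er k T"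
proof -
  show ?thesis
  proof (rule free_end_variation[OF aT Tb n continuous_Nl continuous_Nr first_variation_by_parts])
    fix el er
    assume del: "\<And>k t. k \<le> n \<Longrightarrow> t \<in> {a..T} \<Longrightarrow>
        (el (Suc k) has_vector_derivative - (Nl k t + el k t)) (at t within {a..T})"
    and der: "\<And>k t. k \<le> n \<Longrightarrow> t \<in> {T..b} \<Longrightarrow>
        (er (Suc k) has_vector_derivative - (Nr k t + er k t)) (at t within {T..b})"
    and e0: "\<And>t. t \<in> {a..T} \<Longrightarrow> el (Suc n) t = 0" "\<And>t. t \<in> {T..b} \<Longrightarrow> er (Suc n) t = 0"
    "\<And>t. el 0 t = 0" "\<And>t. er 0 t = 0"
    and e: "\<And>k. er k b = 0"
    "el 1 T = er 1 T + deriv (\<phi> T) (x T)" "\<And>k. k \<ge> 2 \<Longrightarrow> el k T = er k T"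
  show ?thesis
  proof (rule that[of el er])
    fix k t assume k: "1 \<le> k" "k \<le> n" and t: "t \<in> {a..T}" and s: "\<And>i. i \<in> {k..n} \<Longrightarrow> left_smooth k i t"
    have N: "nth_differentiable_at {a..T} (i - k) (Nl i) t \<and> nth_deriv {a..T} (i - k) (Nl i) t =
      fst (\<gamma> i) * nth_deriv {a..T} (i - k) (IT i) t + (-1)^i * snd (\<gamma> i) * D (i - k) (aI i) t" if "i \<in> {k..n}" for i
      using k that by (intro nth_deriv_Nl[OF _ t s[OF that]]) auto
    have "el k t = - (\<Sum>i=k..n. (-1)^(i-k) * nth_deriv {a..T} (i - k) (Nl i) t)"
      using k N by (intro backward_chain_formula[OF aT e0(1) del _ t]) auto
    also have "(\<Sum>i=k..n. (-1)^(i-k) * nth_deriv {a..T} (i - k) (Nl i) t) =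
        (\<Sum>i=k..n. (-1)^(i-k) * (fst (\<gamma> i) * nth_deriv {a..T} (i - k) (IT i) t + (-1)^i * snd (\<gamma> i) * D (i - k) (aI i) t))"
      using N by (intro sum.cong refl arg_cong2[of _ _ _ _ "(*)"]) blast
    finally show "el k t = - (\<Sum>i=k..n. (-1)^(i-k) * (fst (\<gamma> i) * nth_deriv {a..T} (i - k) (IT i) t + (-1)^i * snd (\<gamma> i) * D (i - k) (aI i) t))" .
  next
    fix k t assume k: "1 \<le> k" "k \<le> n" and t: "t \<in> {T..b}" and s: "\<And>i. i \<in> {k..n} \<Longrightarrow> right_smooth k i t"
    have N: "nth_differentiable_at {T..b} (i - k) (Nr i) t \<and> nth_deriv {T..b} (i - k) (Nr i) t =
      (-1)^i * snd (\<gamma> i) * (D (i - k) (aI i) t - nth_deriv {T..b} (i - k) (TI i) t)" if "i \<in> {k..n}" for i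
      using k that by (intro nth_deriv_Nr[OF _ t s[OF that]]) auto
    have "er k t = - (\<Sum>i=k..n. (-1)^(i-k) * nth_deriv {T..b} (i - k) (Nr i) t)"
      using k N by (intro backward_chain_formula[OF Tb e0(2) der _ t]) auto
    also have "(\<Sum>i=k..n. (-1)^(i-k) * nth_deriv {T..b} (i - k) (Nr i) t) =
        (\<Sum>i=k..n. (-1)^(i-k) * ((-1)^i * snd (\<gamma> i) * (D (i - k) (aI i) t - nth_deriv {T..b} (i - k) (TI i) t)))"
      using N by (intro sum.cong refl arg_cong2[of _ _ _ _ "(*)"]) blast
    finally show "er k t = - (\<Sum>i=k..n. (-1)^(i-k) * ((-1)^i * snd (\<gamma> i) * (D (i - k) (aI i) t - nth_deriv {T..b} (i - k) (TI i) t)))" .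
  next
    fix t assume t: "t \<in> {a..T}" and s: "\<And>i. i \<in> {1..n} \<Longrightarrow> left_smooth 0 i t"
    have N: "nth_differentiable_at {a..T} i (Nl i) t \<and> nth_deriv {a..T} i (Nl i) t =
      fst (\<gamma> i) * nth_deriv {a..T} i (IT i) t + (-1)^i * snd (\<gamma> i) * D i (aI i) t" if "i \<in> {1..n}" for i
      using nth_deriv_Nl[OF _ t s[OF that]] that by simp
    \<comment> \<open>For i = 0 the order is 0 and the requirement is vacuous; \<open>dL 2\<close>
      is only known to be continuous.\<close>
    have d: "nth_differentiable_at {a..T} (i - 0) (Nl i) t" if "i \<in> {0..n}" for i
      using N[of i] that by (cases "i = 0") auto
    have "el 0 t = - (\<Sum>i=0..n. (-1)^(i-0) * nth_deriv {a..T} (i - 0) (Nl i) t)"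
      by (rule backward_chain_formula[OF aT e0(1) del _ t d]) auto
    moreover have "(\<Sum>i=0..n. (-1)^(i-0) * nth_deriv {a..T} (i - 0) (Nl i) t) =
        dL 2 t + (\<Sum>i=1..n. (-1)^i * nth_deriv {a..T} i (Nl i) t)"
      by (simp add: sum.atLeast_Suc_atMost[of 0 n] Nl_def)
    moreover have "(\<Sum>i=1..n. (-1)^i * nth_deriv {a..T} i (Nl i) t) =
        (\<Sum>i=1..n. (-1)^i * (fst (\<gamma> i) * nth_deriv {a..T} i (IT i) t + (-1)^i * snd (\<gamma> i) * D i (aI i) t))"
      using N by (intro sum.cong refl arg_cong2[of _ _ _ _ "(*)"]) blast
    ultimately show "dL 2 t + (\<Sum>i=1..n. (-1)^i * (fst (\<gamma> i) * nth_deriv {a..T} i (IT i) t + (-1)^i * snd (\<gamma> i) * D i (aI i) t)) = 0"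
      using e0(3)[of t] by linarith
  next
    fix t assume t: "t \<in> {T..b}" and s: "\<And>i. i \<in> {1..n} \<Longrightarrow> right_smooth 0 i t"
    have N: "nth_differentiable_at {T..b} i (Nr i) t \<and> nth_deriv {T..b} i (Nr i) t =
      (-1)^i * snd (\<gamma> i) * (D i (aI i) t - nth_deriv {T..b} i (TI i) t)" if "i \<in> {1..n}" for i
      using nth_deriv_Nr[OF _ t s[OF that]] that by simp
    have d: "nth_differentiable_at {T..b} (i - 0) (Nr i) t" if "i \<in> {0..n}" for i
      using N[of i] that by (cases "i = 0") auto
    have "er 0 t = - (\<Sum>i=0..n. (-1)^(i-0) * nth_deriv {T..b} (i - 0) (Nr i) t)"
      by (rule backward_chain_formula[OF Tb e0(2) der _ t d]) auto
    moreover have "(\<Sum>i=0..n. (-1)^(i-0) * nth_deriv {T..b} (i - 0) (Nr i) t) =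
        (\<Sum>i=1..n. (-1)^i * nth_deriv {T..b} i (Nr i) t)"
      by (simp add: sum.atLeast_Suc_atMost[of 0 n] Nr_def)
    moreover have "(\<Sum>i=1..n. (-1)^i * nth_deriv {T..b} i (Nr i) t) =
        (\<Sum>i=1..n. (-1)^i * ((-1)^i * snd (\<gamma> i) * (D i (aI i) t - nth_deriv {T..b} i (TI i) t)))"
      using N by (intro sum.cong refl arg_cong2[of _ _ _ _ "(*)"]) blast
    ultimately show "(\<Sum>i=1..n. (-1)^i * ((-1)^i * snd (\<gamma> i) * (D i (aI i) t - nth_deriv {T..b} i (TI i) t))) = 0"
      using e0(4)[of t] by linarith
  qed (rule e, assumption?)+
  qed
qed

text \<open>The sign of the right Caputo derivative cancels the sign from the costate formula, which
  leaves the left Riemann-Liouville derivative; the other term keeps its sign, which belongs to the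
  right Riemann-Liouville derivative.\<close>

lemma euler_lagrange_left:
  assumes t: "t \<in> {a..T}" and s: "\<And>i. i \<in> {1..n} \<Longrightarrow> left_smooth 0 i t"
  shows "dL 2 t + (\<Sum>i=1..n. dual_deriv a b T i (\<alpha> i) (\<beta> i) (\<gamma> i) (dL (i + 2)) t) = 0"
proof -
  have "dual_deriv a b T i (\<alpha> i) (\<beta> i) (\<gamma> i) (dL (i + 2)) t =
    (-1)^i * (fst (\<gamma> i) * nth_deriv {a..T} i (IT i) t + (-1)^i * snd (\<gamma> i) * D i (aI i) t)" for i
    using minus_one_cancel[of i "snd (\<gamma> i) * D i (aI i) t"]
    by (simp add: dual_deriv_def left_RL_def right_RL_def distrib_left mult_ac)
  then have eq: "(\<Sum>i=1..n. dual_deriv a b T i (\<alpha> i) (\<beta> i) (\<gamma> i) (dL (i + 2)) t) =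
    (\<Sum>i=1..n. (-1)^i * (fst (\<gamma> i) * nth_deriv {a..T} i (IT i) t + (-1)^i * snd (\<gamma> i) * D i (aI i) t))"
    by (intro sum.cong refl)
  show ?thesis
  proof (rule costates)
    assume 1: "\<And>t. t \<in> {a..T} \<Longrightarrow> (\<And>i. i \<in> {1..n} \<Longrightarrow> left_smooth 0 i t) \<Longrightarrow>
      dL 2 t + (\<Sum>i=1..n. (-1)^i * (fst (\<gamma> i) * nth_deriv {a..T} i (IT i) t + (-1)^i * snd (\<gamma> i) * D i (aI i) t)) = 0"
    show ?thesis unfolding eq by (rule 1[OF t s])
  qed
qed

lemma euler_lagrange_right:
  assumes t: "t \<in> {T..b}" and s: "\<And>i. i \<in> {1..n} \<Longrightarrow> right_smooth 0 i t"
  shows "(\<Sum>i=1..n. snd (\<gamma> i) * (left_RL b i (\<beta> i) a (dL (i + 2)) t - left_RL b i (\<beta> i) T (dL (i + 2)) t)) = 0"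
proof -
  have "snd (\<gamma> i) * (left_RL b i (\<beta> i) a (dL (i + 2)) t - left_RL b i (\<beta> i) T (dL (i + 2)) t) =
    (-1)^i * ((-1)^i * snd (\<gamma> i) * (D i (aI i) t - nth_deriv {T..b} i (TI i) t))" for i
    by (simp add: left_RL_def minus_one_cancel mult.assoc)
  then have eq: "(\<Sum>i=1..n. snd (\<gamma> i) * (left_RL b i (\<beta> i) a (dL (i + 2)) t - left_RL b i (\<beta> i) T (dL (i + 2)) t)) =
    (\<Sum>i=1..n. (-1)^i * ((-1)^i * snd (\<gamma> i) * (D i (aI i) t - nth_deriv {T..b} i (TI i) t)))"
    by (intro sum.cong refl)
  show ?thesis
  proof (rule costates)
    assume 1: "\<And>t. t \<in> {T..b} \<Longrightarrow> (\<And>i. i \<in> {1..n} \<Longrightarrow> right_smooth 0 i t) \<Longrightarrow>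
      (\<Sum>i=1..n. (-1)^i * ((-1)^i * snd (\<gamma> i) * (D i (aI i) t - nth_deriv {T..b} i (TI i) t))) = 0"
    show ?thesis unfolding eq by (rule 1[OF t s])
  qed
qed

text \<open>Here s, r and q stand for the powers of -1 with exponents i - k, i and k, and X, Y, Z
  for the derivatives of \<open>IT\<close>, \<open>aI\<close> and \<open>TI\<close>; the terms in Y
  cancel.\<close>

lemma jump_identity:
  fixes q :: real
  assumes "s * r = q"
  shows "A * s * X + B * q * Z = s * (A * X + r * B * Y) - s * (r * B * (Y - Z))"
  by (simp add: assms[symmetric] algebra_simps)

lemma end_identity:
  fixes q :: real
  assumes "q = s * r"
  shows "B * q * Y = s * (r * B * Y)"
  by (simp add: assms)

text \<open>\<open>aI\<close> has the same derivatives at T from both sides, so it drops out of the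
  difference of the two costates and only \<open>IT\<close> and \<open>TI\<close> remain. The end
  cost shows up at k = 1 alone.\<close>

lemma transversality_jump:
  assumes k: "k \<in> {1..n}" and s: "\<And>i. i \<in> {k..n} \<Longrightarrow> left_smooth k i T \<and> right_smooth k i T"
  shows "(\<Sum>i=k..n. fst (\<gamma> i) * (-1)^(i-k) * nth_deriv {a..T} (i-k) (IT i) T
                     + snd (\<gamma> i) * (-1)^k * nth_deriv {T..b} (i-k) (TI i) T)
    + (if k = 1 then deriv (\<phi> T) (x T) else 0) = 0"
proof -
  obtain el er where e: "el k T = - (\<Sum>i=k..n. (-1)^(i-k) * (fst (\<gamma> i) * nth_deriv {a..T} (i - k) (IT i) T + (-1)^i * snd (\<gamma> i) * D (i - k) (aI i) T))"
    "er k T = - (\<Sum>i=k..n. (-1)^(i-k) * ((-1)^i * snd (\<gamma> i) * (D (i - k) (aI i) T - nth_deriv {T..b} (i - k) (TI i) T)))"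
    "el k T = er k T + (if k = 1 then deriv (\<phi> T) (x T) else 0)"
  proof (rule costates)
    fix el er
    assume 1: "\<And>k t. 1 \<le> k \<Longrightarrow> k \<le> n \<Longrightarrow> t \<in> {a..T} \<Longrightarrow> (\<And>i. i \<in> {k..n} \<Longrightarrow> left_smooth k i t) \<Longrightarrow>
      el k t = - (\<Sum>i=k..n. (-1)^(i-k) * (fst (\<gamma> i) * nth_deriv {a..T} (i - k) (IT i) t + (-1)^i * snd (\<gamma> i) * D (i - k) (aI i) t))"
    and 2: "\<And>k t. 1 \<le> k \<Longrightarrow> k \<le> n \<Longrightarrow> t \<in> {T..b} \<Longrightarrow> (\<And>i. i \<in> {k..n} \<Longrightarrow> right_smooth k i t) \<Longrightarrow>
      er k t = - (\<Sum>i=k..n. (-1)^(i-k) * ((-1)^i * snd (\<gamma> i) * (D (i - k) (aI i) t - nth_deriv {T..b} (i - k) (TI i) t)))"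
    and 3: "el 1 T = er 1 T + deriv (\<phi> T) (x T)" "\<And>k. k \<ge> 2 \<Longrightarrow> el k T = er k T"
    have "el k T = er k T + (if k = 1 then deriv (\<phi> T) (x T) else 0)"
      using 3 k by (cases "k = 1") auto
    moreover note 1[of k T] 2[of k T]
    ultimately show ?thesis
      using k s aT Tb by (intro that[of el er]) auto
  qed
  have "(\<Sum>i=k..n. fst (\<gamma> i) * (-1)^(i-k) * nth_deriv {a..T} (i-k) (IT i) T
                     + snd (\<gamma> i) * (-1)^k * nth_deriv {T..b} (i-k) (TI i) T) =
     (\<Sum>i=k..n. (-1)^(i-k) * (fst (\<gamma> i) * nth_deriv {a..T} (i - k) (IT i) T + (-1)^i * snd (\<gamma> i) * D (i - k) (aI i) T)
       - (-1)^(i-k) * ((-1)^i * snd (\<gamma> i) * (D (i - k) (aI i) T - nth_deriv {T..b} (i - k) (TI i) T)))"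
  proof (rule sum.cong[OF refl])
    fix i assume "i \<in> {k..n}"
    then have "(-1::real)^(i-k) * (-1)^i = (-1)^k" by (simp add: minus_one_diff)
    then show "fst (\<gamma> i) * (-1)^(i-k) * nth_deriv {a..T} (i-k) (IT i) T + snd (\<gamma> i) * (-1)^k * nth_deriv {T..b} (i-k) (TI i) T =
      (-1)^(i-k) * (fst (\<gamma> i) * nth_deriv {a..T} (i - k) (IT i) T + (-1)^i * snd (\<gamma> i) * D (i - k) (aI i) T)
       - (-1)^(i-k) * ((-1)^i * snd (\<gamma> i) * (D (i - k) (aI i) T - nth_deriv {T..b} (i - k) (TI i) T))"
      by (rule jump_identity)
  qed
  then show ?thesis
    using e unfolding sum_subtractf by linarith
qed

text \<open>No cost is attached to b, so all costates of index 1 to n vanish there, without the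
  exception that k = 1 makes at T.\<close>

lemma transversality_end:
  assumes k: "k \<in> {1..n}" and s: "\<And>i. i \<in> {k..n} \<Longrightarrow> right_smooth k i b"
  shows "(\<Sum>i=k..n. snd (\<gamma> i) * (-1)^k * (D (i-k) (aI i) b - nth_deriv {T..b} (i-k) (TI i) b)) = 0"
proof -
  have 0: "(\<Sum>i=k..n. (-1)^(i-k) * ((-1)^i * snd (\<gamma> i) * (D (i - k) (aI i) b - nth_deriv {T..b} (i - k) (TI i) b))) = 0"
  proof (rule costates)
    fix el er :: "nat \<Rightarrow> real \<Rightarrow> real"
    assume 2: "\<And>k t. 1 \<le> k \<Longrightarrow> k \<le> n \<Longrightarrow> t \<in> {T..b} \<Longrightarrow> (\<And>i. i \<in> {k..n} \<Longrightarrow> right_smooth k i t) \<Longrightarrow>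
      er k t = - (\<Sum>i=k..n. (-1)^(i-k) * ((-1)^i * snd (\<gamma> i) * (D (i - k) (aI i) t - nth_deriv {T..b} (i - k) (TI i) t)))"
    and 3: "\<And>k. er k b = 0"
    have "er k b = - (\<Sum>i=k..n. (-1)^(i-k) * ((-1)^i * snd (\<gamma> i) * (D (i - k) (aI i) b - nth_deriv {T..b} (i - k) (TI i) b)))"
      using k s Tb by (intro 2) auto
    then show ?thesis using 3[of k] by linarith
  qed
  show ?thesis
    unfolding 0[symmetric]
  proof (rule sum.cong[OF refl])
    fix i assume "i \<in> {k..n}"
    then have "(-1::real)^k = (-1)^(i-k) * (-1)^i" by (simp add: minus_one_diff)
    then show "snd (\<gamma> i) * (-1)^k * (D (i-k) (aI i) b - nth_deriv {T..b} (i-k) (TI i) b) =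
      (-1)^(i-k) * ((-1)^i * snd (\<gamma> i) * (D (i - k) (aI i) b - nth_deriv {T..b} (i - k) (TI i) b))"
      by (rule end_identity)
  qed
qed

end

theorem theorem47:
  fixes a b T xa :: real and n :: nat
    and \<alpha> \<beta> :: "nat \<Rightarrow> real \<Rightarrow> real \<Rightarrow> real"
    and \<gamma> :: "nat \<Rightarrow> real \<times> real"
    and L :: "(nat \<Rightarrow> real) \<Rightarrow> real"
    and \<phi> :: "real \<Rightarrow> real \<Rightarrow> real"
    and xa' :: "nat \<Rightarrow> real"
    and x :: "real \<Rightarrow> real"
  assumes "a < b" and "n \<ge> 1"
    and "\<forall>i\<in>{1..n}. continuous_on ({a..b} \<times> {a..b}) (\<lambda>(t, \<tau>). \<alpha> i t \<tau>)"
    and "\<forall>i\<in>{1..n}. \<forall>t\<in>{a..b}. \<forall>\<tau>\<in>{a..b}. \<alpha> i t \<tau> \<in> {real i - 1<..<real i}"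
    and "\<forall>i\<in>{1..n}. continuous_on ({a..b} \<times> {a..b}) (\<lambda>(t, \<tau>). \<beta> i t \<tau>)"
    and "\<forall>i\<in>{1..n}. \<forall>t\<in>{a..b}. \<forall>\<tau>\<in>{a..b}. \<beta> i t \<tau> \<in> {real i - 1<..<real i}"
    and "\<forall>i\<in>{1..n}. \<gamma> i \<in> {0..1} \<times> {0..1} \<and> \<gamma> i \<noteq> (0, 0)"
    and "C1_slab a b (n+2) L"
    and "C1_slab a b 2 (\<lambda>v. \<phi> (v 1) (v 2))"
    and "gives_minimum a b n \<alpha> \<beta> \<gamma> L \<phi> xa xa' x T"
    and "a < T" and "T < b"
  shows
    "let f = (\<lambda>i. partial_L a b n \<alpha> \<beta> \<gamma> L x (i+2));
         aI = (\<lambda>i. left_int i (\<beta> i) a (f i));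
         TI = (\<lambda>i. left_int i (\<beta> i) T (f i));
         IT = (\<lambda>i. right_int i (\<alpha> i) T (f i))
     in
      (\<forall>t\<in>{a..T}.
         (\<forall>i\<in>{1..n}.
            (fst (\<gamma> i) \<noteq> 0 \<longrightarrow> nth_differentiable_at {a..T} i (IT i) t) \<and>
            (snd (\<gamma> i) \<noteq> 0 \<longrightarrow> nth_differentiable_at {a..b} i (aI i) t)) \<longrightarrow>
         partial_L a b n \<alpha> \<beta> \<gamma> L x 2 t
           + (\<Sum>i=1..n. dual_deriv a b T i (\<alpha> i) (\<beta> i) (\<gamma> i) (f i) t) = 0)
    \<and> (\<forall>t\<in>{T..b}.
         (\<forall>i\<in>{1..n}. snd (\<gamma> i) \<noteq> 0 \<longrightarrow>
            nth_differentiable_at {a..b} i (aI i) t \<and>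
            nth_differentiable_at {T..b} i (TI i) t) \<longrightarrow>
         (\<Sum>i=1..n. snd (\<gamma> i) *
            (left_RL b i (\<beta> i) a (f i) t - left_RL b i (\<beta> i) T (f i) t)) = 0)
    \<and> L (args a b n \<alpha> \<beta> \<gamma> x T) + deriv (\<lambda>s. \<phi> s (x T)) T
         + deriv (\<phi> T) (x T) * nth_deriv {a..b} 1 x T = 0
    \<and> ((\<forall>i\<in>{1..n}.
            (fst (\<gamma> i) \<noteq> 0 \<longrightarrow> nth_differentiable_at {a..T} (i-1) (IT i) T) \<and>
            (snd (\<gamma> i) \<noteq> 0 \<longrightarrow> nth_differentiable_at {a..b} (i-1) (aI i) T \<and>
                              nth_differentiable_at {T..b} (i-1) (TI i) T)) \<longrightarrow>
         (\<Sum>i=1..n. fst (\<gamma> i) * (-1)^(i-1) * nth_deriv {a..T} (i-1) (IT i) T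
                   - snd (\<gamma> i) * nth_deriv {T..b} (i-1) (TI i) T)
           + deriv (\<phi> T) (x T) = 0)
    \<and> (\<forall>j\<in>{1..n-1}.
         (\<forall>i\<in>{j+1..n}.
            (fst (\<gamma> i) \<noteq> 0 \<longrightarrow> nth_differentiable_at {a..T} (i-1-j) (IT i) T) \<and>
            (snd (\<gamma> i) \<noteq> 0 \<longrightarrow> nth_differentiable_at {a..b} (i-1-j) (aI i) T \<and>
                              nth_differentiable_at {T..b} (i-1-j) (TI i) T)) \<longrightarrow>
         (\<Sum>i=j+1..n. fst (\<gamma> i) * (-1)^(i-1-j) * nth_deriv {a..T} (i-1-j) (IT i) T
                     + snd (\<gamma> i) * (-1)^(j+1) * nth_deriv {T..b} (i-1-j) (TI i) T) = 0)
    \<and> (\<forall>j\<in>{0..n-1}.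
         (\<forall>i\<in>{j+1..n}. snd (\<gamma> i) \<noteq> 0 \<longrightarrow>
            nth_differentiable_at {a..b} (i-1-j) (aI i) b \<and>
            nth_differentiable_at {T..b} (i-1-j) (TI i) b) \<longrightarrow>
         (\<Sum>i=j+1..n. snd (\<gamma> i) * (-1)^(j+1) *
            (nth_deriv {a..b} (i-1-j) (aI i) b - nth_deriv {T..b} (i-1-j) (TI i) b)) = 0)"
proof -
  interpret variational_problem a b T xa n \<alpha> \<beta> \<gamma> L \<phi> xa' x
    by unfold_locales (use assms in blast)+
  \<comment> \<open>The conditions with index j are those of the costate with index k = j +
    1.\<close>
  have shift: "i - 1 - j = i - (j + 1)" for i j :: nat by simp
  show ?thesis
    unfolding Let_def
  proof (intro conjI ballI impI)
    fix t assume "t \<in> {a..T}" "\<forall>i\<in>{1..n}.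
      (fst (\<gamma> i) \<noteq> 0 \<longrightarrow> nth_differentiable_at {a..T} i (IT i) t) \<and>
      (snd (\<gamma> i) \<noteq> 0 \<longrightarrow> nth_differentiable_at {a..b} i (aI i) t)"
    then show "dL 2 t + (\<Sum>i=1..n. dual_deriv a b T i (\<alpha> i) (\<beta> i) (\<gamma> i) (dL (i + 2)) t) = 0"
      by (intro euler_lagrange_left) (unfold diff_zero, blast+)
  next
    fix t assume "t \<in> {T..b}" "\<forall>i\<in>{1..n}. snd (\<gamma> i) \<noteq> 0 \<longrightarrow>
      nth_differentiable_at {a..b} i (aI i) t \<and> nth_differentiable_at {T..b} i (TI i) t"
    then show "(\<Sum>i=1..n. snd (\<gamma> i) *
        (left_RL b i (\<beta> i) a (dL (i + 2)) t - left_RL b i (\<beta> i) T (dL (i + 2)) t)) = 0"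
      by (intro euler_lagrange_right) (unfold diff_zero, blast+)
  next
    show "L (u T) + deriv (\<lambda>s. \<phi> s (x T)) T + deriv (\<phi> T) (x T) * D 1 x T = 0"
      by (rule transversality_time)
  next
    assume "\<forall>i\<in>{1..n}.
      (fst (\<gamma> i) \<noteq> 0 \<longrightarrow> nth_differentiable_at {a..T} (i-1) (IT i) T) \<and>
      (snd (\<gamma> i) \<noteq> 0 \<longrightarrow> nth_differentiable_at {a..b} (i-1) (aI i) T \<and>
                        nth_differentiable_at {T..b} (i-1) (TI i) T)"
    moreover have "(1::nat) \<in> {1..n}" using assms(2) by simp
    ultimately have "(\<Sum>i=1..n. fst (\<gamma> i) * (-1)^(i-1) * nth_deriv {a..T} (i-1) (IT i) T
        + snd (\<gamma> i) * (-1)^1 * nth_deriv {T..b} (i-1) (TI i) T)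
      + (if (1::nat) = 1 then deriv (\<phi> T) (x T) else 0) = 0"
      by (intro transversality_jump) blast+
    then show "(\<Sum>i=1..n. fst (\<gamma> i) * (-1)^(i-1) * nth_deriv {a..T} (i-1) (IT i) T
        - snd (\<gamma> i) * nth_deriv {T..b} (i-1) (TI i) T) + deriv (\<phi> T) (x T) = 0"
      by simp
  next
    fix j assume j: "j \<in> {1..n-1}" and "\<forall>i\<in>{j+1..n}.
      (fst (\<gamma> i) \<noteq> 0 \<longrightarrow> nth_differentiable_at {a..T} (i-1-j) (IT i) T) \<and>
      (snd (\<gamma> i) \<noteq> 0 \<longrightarrow> nth_differentiable_at {a..b} (i-1-j) (aI i) T \<and>
                        nth_differentiable_at {T..b} (i-1-j) (TI i) T)"
    moreover have "j + 1 \<in> {1..n}" using j by auto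
    ultimately have "(\<Sum>i=j+1..n. fst (\<gamma> i) * (-1)^(i-(j+1)) * nth_deriv {a..T} (i-(j+1)) (IT i) T
        + snd (\<gamma> i) * (-1)^(j+1) * nth_deriv {T..b} (i-(j+1)) (TI i) T)
      + (if j + 1 = 1 then deriv (\<phi> T) (x T) else 0) = 0"
      unfolding shift by (intro transversality_jump) blast+
    moreover have "j + 1 \<noteq> 1" using j by simp
    ultimately show "(\<Sum>i=j+1..n. fst (\<gamma> i) * (-1)^(i-1-j) * nth_deriv {a..T} (i-1-j) (IT i) T
        + snd (\<gamma> i) * (-1)^(j+1) * nth_deriv {T..b} (i-1-j) (TI i) T) = 0"
      unfolding shift by (simp only: if_False add_0_right)
  next
    fix j assume j: "j \<in> {0..n-1}" and "\<forall>i\<in>{j+1..n}. snd (\<gamma> i) \<noteq> 0 \<longrightarrow>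
      nth_differentiable_at {a..b} (i-1-j) (aI i) b \<and> nth_differentiable_at {T..b} (i-1-j) (TI i) b"
    moreover have "j + 1 \<in> {1..n}" using j assms(2) by auto
    ultimately show "(\<Sum>i=j+1..n. snd (\<gamma> i) * (-1)^(j+1) *
        (D (i-1-j) (aI i) b - nth_deriv {T..b} (i-1-j) (TI i) b)) = 0"
      unfolding shift by (intro transversality_end) blast+
  qed
qed

end
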